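(* Let $0<p<\infty$ and let $f=h+\overline{g}:\mathbb{D}\to\mathbb{C}$ be a uniformly locally univalent, sense-preserving harmonic mapping whose dilatation $w$ belongs to $Q_{p,0}$ and satisfies $\|w\|<1$. If $F=\log J_f\in\widetilde{\mathcal{Q}}_{p,0}$, then the measure $d\mu(z)=|S_f(z)|^2(1-|z|^2)^{2+p}\,dA(z)$ is a vanishing $p$-Carleson measure.
   Context: $\mathbb{D}$ is the unit disk and $dA$ is Lebesgue area measure. A sense-preserving locally univalent harmonic mapping $f:\mathbb{D}\to\mathbb{C}$ is written $f=h+\overline{g}$ with $h,g$ analytic in $\mathbb{D}$, $h(0)=g(0)=0$, $h'\neq 0$ in $\mathbb{D}$; its dilatation is $w=g'/h'$, an analytic function with $|w|<1$ in $\mathbb{D}$, and its Jacobian is $J_f=|h'|^2-|g'|^2>0$. Write $\|w\|=\sup_{z\in\mathbb{D}}|w(z)|$. With $\partial_z=\frac12(\partial_x-i\partial_y)$, $\partial_{\bar z}=\frac12(\partial_x+i\partial_y)$ and $F=\log J_f$, the Schwarzian derivative of $f$ is $S_f=F_{zz}-\frac12 F_z^2$; explicitly $S_f=S_h+\frac{\overline{w}}{1-|w|^2}\big(w'\frac{h''}{h'}-w''\big)-\frac32\big(\frac{w'\overline{w}}{1-|w|^2}\big)^2$, where $S_h=(h''/h')'-\frac12(h''/h')^2$. The hyperbolic distance is $d_h(z,\xi)=\frac12\log\frac{1+p(z,\xi)}{1-p(z,\xi)}$ with $p(z,\xi)=\left|\frac{z-\xi}{1-\overline{\xi}z}\right|$;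 $f$ is uniformly locally univalent if there is $\rho\in(0,\infty]$ such that $f$ is univalent on every hyperbolic disk of radius $\rho$. For $a\in\mathbb{D}$ let $\varphi_a(z)=\frac{a-z}{1-\overline{a}z}$. For $0<p<\infty$: $Q_{p,0}$ is the space of analytic $u$ on $\mathbb{D}$ with $\lim_{|a|\to1^-}\int_{\mathbb{D}}|u'(z)|^2(1-|\varphi_a(z)|^2)^p\,dA(z)=0$; $\widetilde{\mathcal{Q}}_{p,0}$ is the class of smooth $G:\mathbb{D}\to\mathbb{C}$ with $\lim_{|a|\to1^-}\int_{\mathbb{D}}(|G_z(z)|+|G_{\bar z}(z)|)^2(1-|\varphi_a(z)|^2)^p\,dA(z)=0$. A positive Borel measure $\mu$ on $\mathbb{D}$ is a vanishing $p$-Carleson measure if $\sup_{a\in\mathbb{D}}\int_{\mathbb{D}}|\varphi_a'|^p\,d\mu<\infty$ and $\lim_{|a|\to1^-}\int_{\mathbb{D}}|\varphi_a'(z)|^p\,d\mu(z)=0$. *)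

theory Defs
  imports "HOL-Analysis.Analysis"
begin

abbreviation unit_disk :: "complex set" where "unit_disk \<equiv> ball 0 1"

definition pdx :: "(complex \<Rightarrow> complex) \<Rightarrow> complex \<Rightarrow> complex" where
  "pdx G z = vector_derivative (\<lambda>t::real. G (z + of_real t)) (at 0)"

definition pdy :: "(complex \<Rightarrow> complex) \<Rightarrow> complex \<Rightarrow> complex" where
  "pdy G z = vector_derivative (\<lambda>t::real. G (z + \<i> * of_real t)) (at 0)"

definition dz :: "(complex \<Rightarrow> complex) \<Rightarrow> complex \<Rightarrow> complex" where
  "dz G z = (pdx G z - \<i> * pdy G z) / 2"

definition dzbar :: "(complex \<Rightarrow> complex) \<Rightarrow> complex \<Rightarrow> complex" where
  "dzbar G z = (pdx G z + \<i> * pdy G z) / 2"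

fun iter_pd :: "bool list \<Rightarrow> (complex \<Rightarrow> complex) \<Rightarrow> complex \<Rightarrow> complex" where
  "iter_pd [] G = G"
| "iter_pd (b # bs) G = (if b then pdx else pdy) (iter_pd bs G)"

definition smooth_on :: "complex set \<Rightarrow> (complex \<Rightarrow> complex) \<Rightarrow> bool" where
  "smooth_on S G \<longleftrightarrow> (\<forall>bs. \<forall>z\<in>S. iter_pd bs G differentiable (at z))"

definition disk_auto :: "complex \<Rightarrow> complex \<Rightarrow> complex" where
  "disk_auto a z = (a - z) / (1 - cnj a * z)"

definition tends_zero_at_boundary :: "(complex \<Rightarrow> ennreal) \<Rightarrow> bool" where
  "tends_zero_at_boundary I \<longleftrightarrow>
     (\<forall>e>0. \<exists>r<1. \<forall>a\<in>unit_disk. r < cmod a \<longrightarrow> I a < ennreal e)"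

definition Qp0 :: "real \<Rightarrow> (complex \<Rightarrow> complex) set" where
  "Qp0 p = {u. u holomorphic_on unit_disk \<and>
     tends_zero_at_boundary (\<lambda>a. \<integral>\<^sup>+ z. indicator unit_disk z *
        ennreal ((cmod (deriv u z))\<^sup>2 * (1 - (cmod (disk_auto a z))\<^sup>2) powr p) \<partial>lborel)}"

definition Qtilde_p0 :: "real \<Rightarrow> (complex \<Rightarrow> complex) set" where
  "Qtilde_p0 p = {G. smooth_on unit_disk G \<and>
     tends_zero_at_boundary (\<lambda>a. \<integral>\<^sup>+ z. indicator unit_disk z *
        ennreal ((cmod (dz G z) + cmod (dzbar G z))\<^sup>2 * (1 - (cmod (disk_auto a z))\<^sup>2) powr p) \<partial>lborel)}"

definition vanishing_carleson :: "real \<Rightarrow> complex measure \<Rightarrow> bool" where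
  "vanishing_carleson p \<mu> \<longleftrightarrow>
     (SUP a\<in>unit_disk. \<integral>\<^sup>+ z. ennreal ((cmod (deriv (disk_auto a) z)) powr p) \<partial>\<mu>) < \<infinity> \<and>
     tends_zero_at_boundary (\<lambda>a. \<integral>\<^sup>+ z. ennreal ((cmod (deriv (disk_auto a) z)) powr p) \<partial>\<mu>)"

definition hyp_dist :: "complex \<Rightarrow> complex \<Rightarrow> real" where
  "hyp_dist z \<xi> = (let q = cmod ((z - \<xi>) / (1 - cnj \<xi> * z)) in ln ((1 + q) / (1 - q)) / 2)"

definition unif_locally_univalent :: "(complex \<Rightarrow> complex) \<Rightarrow> bool" where
  "unif_locally_univalent f \<longleftrightarrow>
     (\<exists>\<rho>::ereal. 0 < \<rho> \<and>
        (\<forall>\<xi>\<in>unit_disk. inj_on f {z\<in>unit_disk. ereal (hyp_dist z \<xi>) < \<rho>}))"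

definition harm :: "(complex \<Rightarrow> complex) \<Rightarrow> (complex \<Rightarrow> complex) \<Rightarrow> complex \<Rightarrow> complex" where
  "harm h g z = h z + cnj (g z)"

definition dilatation :: "(complex \<Rightarrow> complex) \<Rightarrow> (complex \<Rightarrow> complex) \<Rightarrow> complex \<Rightarrow> complex" where
  "dilatation h g z = deriv g z / deriv h z"

definition jacobian :: "(complex \<Rightarrow> complex) \<Rightarrow> (complex \<Rightarrow> complex) \<Rightarrow> complex \<Rightarrow> real" where
  "jacobian h g z = (cmod (deriv h z))\<^sup>2 - (cmod (deriv g z))\<^sup>2"

definition logJ :: "(complex \<Rightarrow> complex) \<Rightarrow> (complex \<Rightarrow> complex) \<Rightarrow> complex \<Rightarrow> complex" where
  "logJ h g z = complex_of_real (ln (jacobian h g z))"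

definition schwarzian :: "(complex \<Rightarrow> complex) \<Rightarrow> (complex \<Rightarrow> complex) \<Rightarrow> complex \<Rightarrow> complex" where
  "schwarzian h g z = dz (dz (logJ h g)) z - (dz (logJ h g) z)\<^sup>2 / 2"

end

theory Submission
  imports Defs "HOL-Complex_Analysis.Complex_Analysis"
begin

text \<open>
  Write \<open>P = h'' / h'\<close> and \<open>K\<^sub>a = (1 - |\<phi>\<^sub>a|\<^sup>2) powr p\<close>. Since \<open>(1 - |z|\<^sup>2) |\<phi>\<^sub>a'| = 1 - |\<phi>\<^sub>a|\<^sup>2\<close>,
  the quantity to control is \<open>\<integral> |S|\<^sup>2 (1 - |z|\<^sup>2)\<^sup>2 K\<^sub>a dA\<close>. As \<open>F\<^sub>z = P - w' cnj w / (1 - |w|\<^sup>2)\<close> and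
  \<open>|w|\<close> stays away from 1, \<open>\<integral> |P|\<^sup>2 K\<^sub>a dA\<close> is bounded by the integrals of \<open>|F\<^sub>z|\<^sup>2\<close> and \<open>|w'|\<^sup>2\<close>, and
  \<open>|S|\<^sup>2\<close> is bounded by \<open>|P'|\<^sup>2 + |w''|\<^sup>2 + |P|\<^sup>4 + |w'|\<^sup>4\<close> up to a constant. The area mean value property and
  \<open>K\<^sub>a(z) \<le> 16 powr p * K\<^sub>a(x)\<close> for \<open>|x - z| < (1 - |z|) / 2\<close> give, for analytic \<open>u\<close>, both
  \<open>\<integral> |u'|\<^sup>2 (1 - |z|\<^sup>2)\<^sup>2 K\<^sub>a dA \<le> C \<integral> |u|\<^sup>2 K\<^sub>a dA\<close> and \<open>|u(a)|\<^sup>2 (1 - |a|\<^sup>2)\<^sup>2 \<le> C \<integral> |u|\<^sup>2 K\<^sub>a dA\<close>.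
  The first handles \<open>P'\<close> and \<open>w''\<close>; the second makes \<open>|P| (1 - |z|\<^sup>2)\<close> and \<open>|w'| (1 - |z|\<^sup>2)\<close> bounded,
  which reduces the fourth powers to squares.
\<close>


section \<open>Invariance of area measure under translations and rotations\<close>

lemma nn_integral_lborel_translate:
  fixes f :: "'a::euclidean_space \<Rightarrow> ennreal"
  assumes [measurable]: "f \<in> borel_measurable borel"
  shows "(\<integral>\<^sup>+x. f (t + x) \<partial>lborel) = (\<integral>\<^sup>+x. f x \<partial>lborel)"
proof -
  have "(\<integral>\<^sup>+x. f x \<partial>lborel) = (\<integral>\<^sup>+x. f x \<partial>distr lborel borel (\<lambda>x. t + x))"
    using lborel_affine[of 1 t] by (simp add: density_1)
  also have "\<dots> = (\<integral>\<^sup>+x. f (t + x) \<partial>lborel)"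
    by (rule nn_integral_distr) auto
  finally show ?thesis ..
qed

text \<open>The argument for uniqueness of Haar measure: convolve with the indicator of the unit ball,
  which is invariant under the rotation.\<close>

lemma nn_integral_lborel_rotate:
  fixes f :: "complex \<Rightarrow> ennreal"
  assumes f[measurable]: "f \<in> borel_measurable borel" and c: "cmod c = 1"
  shows "(\<integral>\<^sup>+x. f (c * x) \<partial>lborel) = (\<integral>\<^sup>+x. f x \<partial>lborel)"
proof -
  define B where "B = (indicator (ball (0::complex) 1) :: complex \<Rightarrow> ennreal)"
  have [measurable]: "B \<in> borel_measurable borel" by (simp add: B_def borel_measurable_indicator)
  let ?V = "emeasure lborel (ball (0::complex) 1)"
  have c0: "c \<noteq> 0" using c by auto
  have "(\<integral>\<^sup>+x. f (c * x) \<partial>lborel) * ?V = (\<integral>\<^sup>+x. f (c * x) * (\<integral>\<^sup>+y. B (c * x - y) \<partial>lborel) \<partial>lborel)"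
  proof -
    have "(\<integral>\<^sup>+y. B (c * x - y) \<partial>lborel) = ?V" for x
    proof -
      have "(\<integral>\<^sup>+y. B (c * x - y) \<partial>lborel) = (\<integral>\<^sup>+y. indicator (ball (c * x) 1) y \<partial>lborel)"
        by (intro nn_integral_cong) (auto simp: B_def indicator_def dist_norm norm_minus_commute)
      also have "\<dots> = ?V" by (simp add: emeasure_ball)
      finally show ?thesis .
    qed
    then show ?thesis by (simp add: nn_integral_multc)
  qed
  also have "\<dots> = (\<integral>\<^sup>+x. \<integral>\<^sup>+y. f (c * x) * B (c * x - y) \<partial>lborel \<partial>lborel)"
    by (subst nn_integral_cmult[symmetric]) auto
  also have "\<dots> = (\<integral>\<^sup>+y. \<integral>\<^sup>+x. f (c * x) * B (c * x - y) \<partial>lborel \<partial>lborel)"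
    by (rule lborel_pair.Fubini') measurable
  also have "\<dots> = (\<integral>\<^sup>+y. \<integral>\<^sup>+x. f (y + c * x) * B (c * x) \<partial>lborel \<partial>lborel)"
  proof (rule nn_integral_cong)
    fix y
    show "(\<integral>\<^sup>+x. f (c * x) * B (c * x - y) \<partial>lborel) = (\<integral>\<^sup>+x. f (y + c * x) * B (c * x) \<partial>lborel)"
      \<comment> \<open>Shifting \<open>x\<close> by \<open>y / c\<close> turns \<open>c * x\<close>
        into \<open>y + c * x\<close>, so \<open>y\<close> moves from \<open>B\<close> to
        \<open>f\<close>; after the next exchange of integrals the inner integral over
        \<open>y\<close> is a pure translate of \<open>f\<close>.\<close>
      using nn_integral_lborel_translate[of "\<lambda>x. f (c * x) * B (c * x - y)" "y / c"] c0
      by (simp add: ring_distribs)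
  qed
  also have "\<dots> = (\<integral>\<^sup>+x. \<integral>\<^sup>+y. f (y + c * x) * B (c * x) \<partial>lborel \<partial>lborel)"
    by (rule lborel_pair.Fubini') measurable
  also have "\<dots> = (\<integral>\<^sup>+x. (\<integral>\<^sup>+y. f y \<partial>lborel) * B x \<partial>lborel)"
  proof (intro nn_integral_cong)
    fix x
    have "B (c * x) = B x" using c by (auto simp: B_def indicator_def norm_mult)
    then show "(\<integral>\<^sup>+y. f (y + c * x) * B (c * x) \<partial>lborel) = (\<integral>\<^sup>+y. f y \<partial>lborel) * B x"
      using nn_integral_lborel_translate[OF f, of "c * x"]
      by (simp add: nn_integral_multc add.commute)
  qed
  also have "\<dots> = (\<integral>\<^sup>+y. f y \<partial>lborel) * ?V"
    by (simp add: B_def nn_integral_cmult_indicator)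
  finally have eq: "(\<integral>\<^sup>+x. f (c * x) \<partial>lborel) * ?V = (\<integral>\<^sup>+x. f x \<partial>lborel) * ?V" .
  \<comment> \<open>The area of the ball is finite and nonzero, hence can be cancelled in
    \<open>ennreal\<close>.\<close>
  have V: "?V = ennreal pi" by (simp add: emeasure_ball unit_ball_vol_2)
  have "x = y" if "x * ennreal pi = y * ennreal pi" for x y
    using arg_cong[OF that, of "\<lambda>z. z / ennreal pi"]
    by (simp add: ennreal_times_divide [symmetric] ennreal_divide_self mult.commute)
  then show ?thesis using eq V by simp
qed

text \<open>For each fixed \<open>t\<close> the inner map is a rotation followed by a translation
  and preserves the integral, and \<open>t\<close> runs over an interval of length 1. This takes the
  place of polar coordinates in passing from circle means to area means.\<close>

lemma nn_integral_rotation_average: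
  fixes f :: "complex \<Rightarrow> ennreal"
  assumes [measurable]: "f \<in> borel_measurable borel"
  shows "(\<integral>\<^sup>+x. f x \<partial>lborel) =
    (\<integral>\<^sup>+x. \<integral>\<^sup>+t. indicator {0..1} t * f (z + x * exp (2 * of_real pi * \<i> * of_real t)) \<partial>lborel \<partial>lborel)"
    (is "_ = ?R")
proof -
  let ?e = "\<lambda>t::real. exp (2 * of_real pi * \<i> * of_real t) :: complex"
  have [measurable]: "?e \<in> borel_measurable borel"
    by (intro borel_measurable_continuous_onI continuous_intros)
  have e: "cmod (?e t) = 1" for t by simp
  have "?R = (\<integral>\<^sup>+t. \<integral>\<^sup>+x. indicator {0..1} t * f (z + x * ?e t) \<partial>lborel \<partial>lborel)"
    by (rule lborel_pair.Fubini') measurable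
  also have "\<dots> = (\<integral>\<^sup>+t. indicator {0..1::real} t * (\<integral>\<^sup>+x. f x \<partial>lborel) \<partial>lborel)"
  proof (intro nn_integral_cong)
    fix t :: real
    have "(\<integral>\<^sup>+x. f (z + x * ?e t) \<partial>lborel) = (\<integral>\<^sup>+x. f x \<partial>lborel)"
      using nn_integral_lborel_rotate[of "\<lambda>x. f (z + x)" "?e t"] e nn_integral_lborel_translate[of f z]
      by (simp add: mult.commute)
    then show "(\<integral>\<^sup>+x. indicator {0..1} t * f (z + x * ?e t) \<partial>lborel) = indicator {0..1} t * (\<integral>\<^sup>+x. f x \<partial>lborel)"
      by (simp add: nn_integral_cmult)
  qed
  also have "\<dots> = (\<integral>\<^sup>+x. f x \<partial>lborel)"
    by (simp add: nn_integral_multc)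
  finally show ?thesis ..
qed

section \<open>Mean value inequalities for analytic functions\<close>

text \<open>Cauchy's formula at 0 for \<open>\<lambda>u. f (z + x * u)\<close> on the unit circle.
  Keeping the radius as a complex number \<open>x\<close>, possibly 0, matches the integrand of
  \<open>nn_integral_rotation_average\<close>.\<close>

lemma circle_mean_value:
  assumes holo: "f holomorphic_on ball z r" and x: "cmod x < r"
  shows "ennreal (cmod (f z)) \<le>
    (\<integral>\<^sup>+t. indicator {0..1} t * ennreal (cmod (f (z + x * exp (2 * of_real pi * \<i> * of_real t)))) \<partial>lborel)"
proof -
  let ?e = "\<lambda>t::real. exp (2 * of_real pi * \<i> * of_real t) :: complex"
  define F where "F = (\<lambda>u. f (z + x * u))"
  have sub: "z + x * u \<in> ball z r" if "u \<in> cball 0 1" for u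
  proof -
    have "cmod (x * u) \<le> cmod x" using that by (simp add: norm_mult mult_left_le)
    then show ?thesis using x by (simp add: dist_norm)
  qed
  have cF: "continuous_on (cball 0 1) F"
    unfolding F_def
    by (rule continuous_on_compose2[OF holomorphic_on_imp_continuous_on[OF holo]])
       (use sub in \<open>auto intro!: continuous_intros\<close>)
  have hF: "F holomorphic_on ball 0 1"
    unfolding F_def
    by (rule holomorphic_on_compose_gen[of _ _ f "ball z r", unfolded o_def, OF _ holo])
       (use sub in \<open>auto intro!: holomorphic_intros\<close>)
  have "((\<lambda>u. F u / (u - 0)) has_contour_integral (2 * of_real pi * \<i> * F 0)) (circlepath 0 1)"
    by (rule Cauchy_integral_circlepath[OF cF hF]) auto
  then have "((\<lambda>t. F (circlepath 0 1 t) / circlepath 0 1 t * vector_derivative (circlepath 0 1) (at t within {0..1}))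
      has_integral (2 * of_real pi * \<i> * F 0)) {0..1}"
    by (simp add: has_contour_integral_def)
  moreover have "F (circlepath 0 1 t) / circlepath 0 1 t * vector_derivative (circlepath 0 1) (at t within {0..1})
      = (2 * of_real pi * \<i>) * F (?e t)" if "t \<in> {0..1}" for t
  proof -
    have "vector_derivative (circlepath 0 1) (at t within {0..1}) = 2 * pi * \<i> * 1 * ?e t"
      using vector_derivative_circlepath01[of t 0 1] that by simp
    then show ?thesis by (simp add: circlepath)
  qed
  ultimately have "((\<lambda>t. (2 * of_real pi * \<i>) * F (?e t)) has_integral (2 * of_real pi * \<i> * F 0)) {0..1}"
    by (rule has_integral_eq[rotated])
  from has_integral_mult_right[OF this, of "inverse (2 * of_real pi * \<i>)"]
  have hi: "((\<lambda>t. F (?e t)) has_integral F 0) {0..1}"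
    by (simp add: field_simps)
  have cont: "continuous_on {0..1} (\<lambda>t. F (?e t))"
    by (rule continuous_on_compose2[OF cF]) (auto intro!: continuous_intros)
  have ni: "(\<lambda>t. cmod (F (?e t))) integrable_on {0..1}"
    by (intro integrable_continuous_real continuous_intros cont)
  have "cmod (F 0) = cmod (integral {0..1} (\<lambda>t. F (?e t)))"
    using hi by (simp add: integral_unique)
  also have "\<dots> \<le> integral {0..1} (\<lambda>t. cmod (F (?e t)))"
    using hi ni by (intro integral_norm_bound_integral) (auto simp: has_integral_integrable)
  finally have le: "cmod (F 0) \<le> integral {0..1} (\<lambda>t. cmod (F (?e t)))" .
  have "(\<integral>\<^sup>+t. indicator {0..1} t * ennreal (cmod (F (?e t))) \<partial>lborel) 
      = (\<integral>\<^sup>+t. ennreal (indicator {0..1} t * cmod (F (?e t))) \<partial>lborel)"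
    by (intro nn_integral_cong) (auto simp: indicator_def)
  also have "\<dots> = ennreal (integral {0..1} (\<lambda>t. cmod (F (?e t))))"
    by (rule nn_integral_has_integral_lebesgue[OF _ integrable_integral[OF ni]]) simp
  finally show ?thesis using le by (auto simp: F_def ennreal_leI)
qed


lemma borel_measurable_indicator_continuous_on:
  fixes q :: "'a::topological_space \<Rightarrow> real"
  assumes "A \<in> sets borel" "continuous_on A q"
  shows "(\<lambda>x. indicator A x * ennreal (q x)) \<in> borel_measurable borel"
proof -
  have "(\<lambda>x. ennreal (indicator A x *\<^sub>R q x)) \<in> borel_measurable borel"
    using borel_measurable_continuous_on_indicator[OF assms] by measurable
  also have "(\<lambda>x. ennreal (indicator A x *\<^sub>R q x)) = (\<lambda>x. indicator A x * ennreal (q x))"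
    by (auto simp: indicator_def)
  finally show ?thesis .
qed

text \<open>The circle inequality, applied to the analytic function \<open>u\<close> squared, is
  integrated over \<open>x\<close> in the ball of radius \<open>r\<close> about 0; the rotation
  average collapses the result to an area integral.\<close>

lemma area_mean_value_square:
  assumes holo: "u holomorphic_on ball z r" and r: "0 < r"
  shows "ennreal ((cmod (u z))\<^sup>2 * (pi * r\<^sup>2)) \<le>
    (\<integral>\<^sup>+x. indicator (ball z r) x * ennreal ((cmod (u x))\<^sup>2) \<partial>lborel)"
proof -
  define V where "V x = indicator (ball z r) x * ennreal ((cmod (u x))\<^sup>2)" for x
  have V: "V \<in> borel_measurable borel"
    unfolding V_def[abs_def]
    by (rule borel_measurable_indicator_continuous_on)
       (auto intro!: continuous_intros holomorphic_on_imp_continuous_on holo)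
  have "ennreal ((cmod (u z))\<^sup>2 * (pi * r\<^sup>2)) = (\<integral>\<^sup>+x. ennreal ((cmod (u z))\<^sup>2) * indicator (ball (0::complex) r) x \<partial>lborel)"
    using r by (simp add: nn_integral_cmult_indicator emeasure_ball unit_ball_vol_2 ennreal_mult)
  also have "\<dots> \<le> (\<integral>\<^sup>+x. \<integral>\<^sup>+t. indicator {0..1} t * V (z + x * exp (2 * of_real pi * \<i> * of_real t)) \<partial>lborel \<partial>lborel)"
  proof (intro nn_integral_mono)
    fix x :: complex
    show "ennreal ((cmod (u z))\<^sup>2) * indicator (ball (0::complex) r) x
      \<le> (\<integral>\<^sup>+t. indicator {0..1} t * V (z + x * exp (2 * of_real pi * \<i> * of_real t)) \<partial>lborel)"
    proof (cases "cmod x < r")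
      case True
      have "(\<lambda>x. (u x)\<^sup>2) holomorphic_on ball z r" by (intro holomorphic_intros holo)
      from circle_mean_value[OF this True]
      have "ennreal ((cmod (u z))\<^sup>2) \<le> (\<integral>\<^sup>+t. indicator {0..1} t * 
         ennreal ((cmod (u (z + x * exp (2 * of_real pi * \<i> * of_real t))))\<^sup>2) \<partial>lborel)"
        by (simp add: norm_power)
      also have "\<dots> = (\<integral>\<^sup>+t. indicator {0..1} t * V (z + x * exp (2 * of_real pi * \<i> * of_real t)) \<partial>lborel)"
        using True by (simp add: V_def dist_norm norm_mult)
      finally show ?thesis using True by simp
    qed simp
  qed
  also have "\<dots> = (\<integral>\<^sup>+x. V x \<partial>lborel)"
    by (rule nn_integral_rotation_average[OF V, symmetric])
  finally show ?thesis unfolding V_def .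
qed

text \<open>A point \<open>x\<close> on the circle of radius \<open>r\<close> about \<open>z\<close>
  has its \<open>r\<close>-ball inside the larger ball, so the area mean value bounds
  \<open>u\<close> there by the square root of \<open>I / (pi * r\<^sup>2)\<close>. Cauchy's
  estimate on that circle costs one more factor \<open>1 / r\<close>, whence the fourth power. An
  infinite integral leaves nothing to show.\<close>

lemma area_deriv_bound:
  assumes holo: "u holomorphic_on ball z (2 * r)" and r: "0 < r"
  shows "ennreal ((cmod (deriv u z))\<^sup>2 * (pi * r ^ 4)) \<le>
    (\<integral>\<^sup>+x. indicator (ball z (2 * r)) x * ennreal ((cmod (u x))\<^sup>2) \<partial>lborel)" (is "_ \<le> ?I")
proof (cases "?I = \<infinity>")
  case False
  then obtain I where I: "?I = ennreal I" "0 \<le> I" by (cases ?I) auto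
  have *: "(cmod (u x))\<^sup>2 \<le> I / (pi * r\<^sup>2)" if "cmod (z - x) = r" for x
  proof -
    have sub: "ball x r \<subseteq> ball z (2 * r)"
    proof
      fix y assume "y \<in> ball x r"
      then show "y \<in> ball z (2 * r)" using that dist_triangle[of z y x] by (simp add: dist_norm)
    qed
    have "ennreal ((cmod (u x))\<^sup>2 * (pi * r\<^sup>2)) \<le>
        (\<integral>\<^sup>+y. indicator (ball x r) y * ennreal ((cmod (u y))\<^sup>2) \<partial>lborel)"
      by (rule area_mean_value_square[OF holomorphic_on_subset[OF holo sub] r])
    also have "\<dots> \<le> ?I"
      using sub by (intro nn_integral_mono mult_right_mono) (auto simp: indicator_def)
    finally have "(cmod (u x))\<^sup>2 * (pi * r\<^sup>2) \<le> I" using I by simp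
    then show ?thesis using r by (simp add: pos_le_divide_eq)
  qed
  have sub: "cball z r \<subseteq> ball z (2 * r)" using r by auto
  have "cmod ((deriv ^^ 1) u z) \<le> fact 1 * sqrt (I / (pi * r\<^sup>2)) / r ^ 1"
  proof (rule Cauchy_inequality)
    show "u holomorphic_on ball z r"
      using holo by (rule holomorphic_on_subset) (use sub in auto)
    show "continuous_on (cball z r) u"
      using holomorphic_on_imp_continuous_on[OF holo] sub by (rule continuous_on_subset)
    show "cmod (u x) \<le> sqrt (I / (pi * r\<^sup>2))" if "cmod (z - x) = r" for x
      using *[OF that] by (simp add: real_le_rsqrt)
  qed (rule r)
  then have "cmod (deriv u z) \<le> sqrt (I / (pi * r\<^sup>2)) / r" by simp
  then have "(cmod (deriv u z))\<^sup>2 \<le> (sqrt (I / (pi * r\<^sup>2)) / r)\<^sup>2" by (intro power_mono) auto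
  also have "\<dots> = I / (pi * r ^ 4)"
    using I(2) r by (simp add: power_divide power2_eq_square power4_eq_xxxx)
  finally have "(cmod (deriv u z))\<^sup>2 * (pi * r ^ 4) \<le> I" using r by (simp add: pos_le_divide_eq)
  then show ?thesis using I by simp
qed simp

section \<open>The kernel built from disk automorphisms and its comparison estimates\<close>

definition moebius_kernel :: "real \<Rightarrow> complex \<Rightarrow> complex \<Rightarrow> real" where
  "moebius_kernel p a z = (1 - (cmod (disk_auto a z))\<^sup>2) powr p"

lemma one_minus_cnj_mult_nonzero:
  assumes "cmod a < 1" "cmod z \<le> 1"
  shows "1 - cnj a * z \<noteq> 0"
proof
  assume "1 - cnj a * z = 0"
  then have "cmod (cnj a * z) = 1" by (metis eq_iff_diff_eq_0 norm_one)
  moreover have "cmod (cnj a * z) < 1"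
  proof -
    have "cmod a * cmod z \<le> cmod a * 1" using assms by (intro mult_left_mono) auto
    then show ?thesis using assms by (simp add: norm_mult)
  qed
  ultimately show False by simp
qed

text \<open>Follows from the identity |1 - cnj a z|^2 - |a - z|^2 = (1 - |a|^2)(1 - |z|^2). The
  factored form lets kernels be compared factor by factor.\<close>

lemma one_minus_norm_disk_auto:
  assumes "cmod a < 1" "cmod z < 1"
  shows "1 - (cmod (disk_auto a z))\<^sup>2 = (1 - (cmod a)\<^sup>2) * (1 - (cmod z)\<^sup>2) / (cmod (1 - cnj a * z))\<^sup>2"
proof -
  have nz: "1 - cnj a * z \<noteq> 0" using one_minus_cnj_mult_nonzero assms by simp
  have "of_real ((cmod (1 - cnj a * z))\<^sup>2 - (cmod (a - z))\<^sup>2) = (of_real ((1 - (cmod a)\<^sup>2) * (1 - (cmod z)\<^sup>2)) :: complex)"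
    by (simp add: complex_norm_square algebra_simps del: of_real_power)
  then have "(cmod (1 - cnj a * z))\<^sup>2 - (cmod (a - z))\<^sup>2 = (1 - (cmod a)\<^sup>2) * (1 - (cmod z)\<^sup>2)"
    by (simp only: of_real_eq_iff)
  then show ?thesis using nz
    by (simp add: disk_auto_def norm_divide power_divide field_simps)
qed

lemma moebius_kernel_nonneg: "0 \<le> moebius_kernel p a z"
  by (simp add: moebius_kernel_def)

lemma moebius_kernel_self: "moebius_kernel p a a = 1"
  by (simp add: moebius_kernel_def disk_auto_def)

lemma continuous_on_moebius_kernel:
  assumes "cmod a < 1"
  shows "continuous_on unit_disk (moebius_kernel p a)"
proof -
  have 1: "continuous_on unit_disk (disk_auto a)"
    unfolding disk_auto_def using one_minus_cnj_mult_nonzero[OF assms]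
    by (auto intro!: continuous_intros)
  \<comment> \<open>The continuity rule for \<open>powr\<close> asks for a nonzero base.\<close>
  have "1 - (cmod (disk_auto a z))\<^sup>2 \<noteq> 0" if "z \<in> unit_disk" for z
  proof -
    have "(cmod a)\<^sup>2 < 1" "(cmod z)\<^sup>2 < 1" using assms that by (auto simp: abs_square_less_1)
    then show ?thesis
      using one_minus_norm_disk_auto[OF assms] one_minus_cnj_mult_nonzero[OF assms, of z] that by auto
  qed
  then show ?thesis unfolding moebius_kernel_def
    by (auto intro!: continuous_intros 1)
qed

text \<open>Monotonicity of \<open>powr\<close>. Both centre and point may differ on the two sides:
  one application moves the point, another moves the centre.\<close>

lemma moebius_kernel_le:
  assumes p: "0 < p" and C: "0 \<le> C" and le: "1 - (cmod (disk_auto a z))\<^sup>2 \<le> C * (1 - (cmod (disk_auto b w))\<^sup>2)"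
    and "cmod a < 1" "cmod z < 1" "cmod b < 1" "cmod w < 1"
  shows "moebius_kernel p a z \<le> C powr p * moebius_kernel p b w"
proof -
  have nn: "0 \<le> 1 - (cmod (disk_auto a z))\<^sup>2" if "cmod a < 1" "cmod z < 1" for a z
    using that by (auto simp: one_minus_norm_disk_auto abs_square_le_1 intro!: divide_nonneg_nonneg mult_nonneg_nonneg)
  have "moebius_kernel p a z \<le> (C * (1 - (cmod (disk_auto b w))\<^sup>2)) powr p"
    unfolding moebius_kernel_def using nn le p assms by (intro powr_mono2) auto
  also have "\<dots> = C powr p * moebius_kernel p b w"
    unfolding moebius_kernel_def by (rule powr_mult)
  finally show ?thesis .
qed

text \<open>A Harnack inequality uniform in \<open>a\<close>. Moving from \<open>z\<close> to
  \<open>w\<close> costs at most 4 in the factor 1 - |z|^2 and at most 4 in |1 - cnj a z|^2, hence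
  16.\<close>

lemma moebius_kernel_harnack:
  assumes p: "0 < p" and a: "cmod a < 1" and z: "cmod z < 1" and w: "cmod (w - z) < (1 - cmod z) / 2"
  shows "moebius_kernel p a z \<le> 16 powr p * moebius_kernel p a w"
proof -
  have w1: "1 - cmod z \<le> 2 * (1 - cmod w)" using w norm_triangle_ineq2[of w z] by (simp add: field_simps)
  then have wl: "cmod w < 1" using z by argo
  have a2: "0 \<le> 1 - (cmod a)\<^sup>2" using a by (simp add: abs_square_le_1)
  have "1 - (cmod z)\<^sup>2 \<le> 2 * (1 - cmod z)"
    using zero_le_power2[of "1 - cmod z"] by (simp add: power2_eq_square algebra_simps)
  moreover have "(cmod w)\<^sup>2 \<le> cmod w" using wl by (simp add: power2_eq_square mult_left_le)
  ultimately have 1: "1 - (cmod z)\<^sup>2 \<le> 4 * (1 - (cmod w)\<^sup>2)" using w1 by argo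
  let ?A = "cmod (1 - cnj a * z)" and ?B = "cmod (1 - cnj a * w)"
  \<comment> \<open>The denominator at \<open>z\<close> is at least 1 - |z|, which exceeds twice the
    displacement |w - z|; so the displacement changes it by less than half.\<close>
  have "1 - cmod z \<le> ?A"
  proof -
    have "cmod a * cmod z \<le> 1 * cmod z" using a by (intro mult_right_mono) auto
    then show ?thesis using norm_triangle_ineq2[of 1 "cnj a * z"] by (simp add: norm_mult)
  qed
  moreover have "?B \<le> ?A + cmod (w - z)"
  proof -
    have "1 - cnj a * w = (1 - cnj a * z) - cnj a * (w - z)" by (simp add: algebra_simps)
    then have "?B \<le> ?A + cmod a * cmod (w - z)" by (metis norm_triangle_ineq4 norm_mult complex_mod_cnj)
    moreover have "cmod a * cmod (w - z) \<le> 1 * cmod (w - z)" using a by (intro mult_right_mono) auto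
    ultimately show ?thesis by simp
  qed
  ultimately have "?B \<le> 2 * ?A" using w z by argo
  then have "?B\<^sup>2 \<le> (2 * ?A)\<^sup>2" by (intro power_mono) auto
  then have 2: "?B\<^sup>2 \<le> 4 * ?A\<^sup>2" by (simp add: power_mult_distrib)
  have A: "0 < ?A" and B: "0 < ?B" using one_minus_cnj_mult_nonzero[OF a] z wl by auto
  have "1 - (cmod (disk_auto a z))\<^sup>2 \<le> 16 * (1 - (cmod (disk_auto a w))\<^sup>2)"
  proof -
    have "(1 - (cmod a)\<^sup>2) * (1 - (cmod z)\<^sup>2) / ?A\<^sup>2 \<le> (1 - (cmod a)\<^sup>2) * (4 * (1 - (cmod w)\<^sup>2)) / (?B\<^sup>2 / 4)"
      using 1 2 a2 A B z by (intro frac_le mult_left_mono) (auto simp: abs_square_le_1 wl less_imp_le)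
    moreover have "x * (4 * y) / (b / 4) = 16 * (x * y / b)" for x y b :: real by simp
    ultimately show ?thesis using a z wl by (simp only: one_minus_norm_disk_auto)
  qed
  then show ?thesis using moebius_kernel_le[OF p, of 16] a z wl by simp
qed


section \<open>Integrals against the kernel\<close>

text \<open>The common form of the integrals in \<open>Qp0\<close>, \<open>Qtilde_p0\<close> and,
  after rewriting, \<open>vanishing_carleson\<close>. With values in \<open>ennreal\<close>,
  estimates can be stated before any finiteness is known.\<close>

definition moebius_integral :: "real \<Rightarrow> complex \<Rightarrow> (complex \<Rightarrow> real) \<Rightarrow> ennreal" where
  "moebius_integral p a q = (\<integral>\<^sup>+z. indicator unit_disk z * ennreal (q z * moebius_kernel p a z) \<partial>lborel)"

lemma moebius_integral_measurable:
  assumes "cmod a < 1" "continuous_on unit_disk q"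
  shows "(\<lambda>z. indicator unit_disk z * ennreal (q z * moebius_kernel p a z)) \<in> borel_measurable borel"
  using assms by (intro borel_measurable_indicator_continuous_on continuous_intros continuous_on_moebius_kernel) auto

lemma moebius_integral_mono:
  assumes "\<And>z. z \<in> unit_disk \<Longrightarrow> q z \<le> q' z"
  shows "moebius_integral p a q \<le> moebius_integral p a q'"
  unfolding moebius_integral_def
  by (intro nn_integral_mono) (auto simp: indicator_def intro!: ennreal_leI mult_right_mono assms moebius_kernel_nonneg)

lemma moebius_integral_cmult:
  assumes "cmod a < 1" "continuous_on unit_disk q" "0 \<le> C"
  shows "moebius_integral p a (\<lambda>z. C * q z) = ennreal C * moebius_integral p a q"
  unfolding moebius_integral_def using assms moebius_integral_measurable[OF assms(1,2)]
  by (subst nn_integral_cmult[symmetric])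
     (auto intro!: nn_integral_cong simp: indicator_def ennreal_mult' mult.assoc)

lemma moebius_integral_add:
  assumes "cmod a < 1" "continuous_on unit_disk q" "continuous_on unit_disk q'"
    and "\<And>z. 0 \<le> q z" "\<And>z. 0 \<le> q' z"
  shows "moebius_integral p a (\<lambda>z. q z + q' z) = moebius_integral p a q + moebius_integral p a q'"
  unfolding moebius_integral_def using assms moebius_integral_measurable[OF assms(1,2)] moebius_integral_measurable[OF assms(1,3)]
  by (subst nn_integral_add[symmetric])
     (auto intro!: nn_integral_cong simp: indicator_def distrib_right moebius_kernel_nonneg ennreal_plus[symmetric] simp del: ennreal_plus)

lemma one_minus_norm_sq_bound:
  assumes "cmod z < 1"
  shows "(1 - (cmod z)\<^sup>2)\<^sup>2 \<le> 4 * (1 - cmod z)\<^sup>2"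
proof -
  have "1 - (cmod z)\<^sup>2 \<le> 2 * (1 - cmod z)"
    using zero_le_power2[of "1 - cmod z"] by (simp add: power2_eq_square algebra_simps)
  then have "(1 - (cmod z)\<^sup>2)\<^sup>2 \<le> (2 * (1 - cmod z))\<^sup>2"
    using assms by (intro power_mono) (auto simp: abs_square_le_1)
  then show ?thesis by (simp only: power_mult_distrib) simp
qed

text \<open>The area mean value on the ball about \<open>a\<close> with radius half the distance to
  the circle. The kernel centred at \<open>a\<close> equals 1 at \<open>a\<close>, so by the Harnack
  inequality it is at least \<open>1 / 16 powr p\<close> on that ball.\<close>

lemma moebius_integral_pointwise:
  assumes p: "0 < p" and holo: "u holomorphic_on unit_disk" and a: "cmod a < 1"
  shows "ennreal ((cmod (u a))\<^sup>2 * (1 - (cmod a)\<^sup>2)\<^sup>2) \<le> ennreal (16 * 16 powr p) * moebius_integral p a (\<lambda>z. (cmod (u z))\<^sup>2)"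
proof -
  define r where "r = (1 - cmod a) / 2"
  have r: "0 < r" "1 - cmod a = 2 * r" using a by (auto simp: r_def)
  have sub: "ball a r \<subseteq> unit_disk"
  proof
    fix y assume "y \<in> ball a r"
    then show "y \<in> unit_disk" using norm_triangle_ineq2[of y a] r by (simp add: dist_norm norm_minus_commute)
  qed
  have "(1 - (cmod a)\<^sup>2)\<^sup>2 \<le> 4 * (2 * r)\<^sup>2" using one_minus_norm_sq_bound[OF a] r by simp
  also have "\<dots> \<le> 16 * (pi * r\<^sup>2)"
    using pi_gt3 mult_right_mono[of 1 pi "r\<^sup>2"] by (simp add: power_mult_distrib)
  finally have m: "(1 - (cmod a)\<^sup>2)\<^sup>2 \<le> 16 * (pi * r\<^sup>2)" .
  have "ennreal ((cmod (u a))\<^sup>2 * (1 - (cmod a)\<^sup>2)\<^sup>2) \<le> ennreal (16 * ((cmod (u a))\<^sup>2 * (pi * r\<^sup>2)))"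
    using mult_left_mono[OF m, of "(cmod (u a))\<^sup>2"] by (intro ennreal_leI) (simp add: mult_ac)
  also have "\<dots> = 16 * ennreal ((cmod (u a))\<^sup>2 * (pi * r\<^sup>2))"
    by (simp add: ennreal_mult)
  also have "\<dots> \<le> 16 * (\<integral>\<^sup>+x. indicator (ball a r) x * ennreal ((cmod (u x))\<^sup>2) \<partial>lborel)"
    by (intro mult_left_mono area_mean_value_square holomorphic_on_subset[OF holo sub] r) simp
  also have "\<dots> \<le> 16 * moebius_integral p a (\<lambda>z. 16 powr p * (cmod (u z))\<^sup>2)"
    unfolding moebius_integral_def
  proof (intro mult_left_mono nn_integral_mono)
    fix x
    show "indicator (ball a r) x * ennreal ((cmod (u x))\<^sup>2)
      \<le> indicator unit_disk x * ennreal (16 powr p * (cmod (u x))\<^sup>2 * moebius_kernel p a x)"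
    proof (cases "x \<in> ball a r")
      case True
      then have "1 \<le> 16 powr p * moebius_kernel p a x"
        using moebius_kernel_harnack[OF p a a, of x] by (simp add: moebius_kernel_self r_def dist_norm norm_minus_commute)
      from mult_left_mono[OF this, of "(cmod (u x))\<^sup>2"] show ?thesis
        using True sub by (auto simp: indicator_def mult_ac intro!: ennreal_leI)
    qed simp
  qed simp
  also have "\<dots> = ennreal (16 * 16 powr p) * moebius_integral p a (\<lambda>z. (cmod (u z))\<^sup>2)"
    by (subst moebius_integral_cmult)
       (auto intro!: a continuous_intros holomorphic_on_imp_continuous_on holo simp: ennreal_mult mult.assoc)
  finally show ?thesis .
qed

text \<open>Each |u'(z)|^2 is replaced by an area integral of |u|^2 over a ball about
  \<open>z\<close>, the kernel at \<open>z\<close> is traded for the kernel at \<open>x\<close>, and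
  the two integrals are exchanged. Then \<open>x\<close> is met by a set of \<open>z\<close> of area
  \<open>pi * (1 - cmod x)\<^sup>2\<close>, which cancels the inverse square in
  \<open>W\<close>.\<close>

lemma moebius_integral_deriv:
  assumes p: "0 < p" and holo: "u holomorphic_on unit_disk" and a: "cmod a < 1"
  shows "moebius_integral p a (\<lambda>z. (cmod (deriv u z))\<^sup>2 * (1 - (cmod z)\<^sup>2)\<^sup>2)
    \<le> ennreal (4096 * 16 powr p) * moebius_integral p a (\<lambda>z. (cmod (u z))\<^sup>2)"
proof -
  \<comment> \<open>4096 is 64 times 64: with \<open>r = (1 - cmod z) / 4\<close>, one 64 bounds
    \<open>(1 - (cmod z)\<^sup>2)\<^sup>2\<close> by \<open>64 * r\<^sup>2\<close>, the other comes
    from \<open>1 - cmod x \<le> 8 * r\<close>. The division by \<open>pi\<close> anticipates the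
    area of a ball.\<close>
  define c where "c = 4096 * 16 powr p / pi"
  have c: "0 \<le> c" by (simp add: c_def)
  define W where "W x = indicator unit_disk x * ennreal (c * (cmod (u x))\<^sup>2 * inverse ((1 - cmod x)\<^sup>2) * moebius_kernel p a x)" for x
  \<comment> \<open>The ball about \<open>z\<close> is enlarged to a condition measured by the
    distance of \<open>x\<close> to the circle, so that for fixed \<open>x\<close> the admissible
    \<open>z\<close> form a ball about \<open>x\<close>.\<close>
  define H where "H z x = (if cmod (x - z) < 1 - cmod x then W x else 0)" for z x
  have [measurable]: "W \<in> borel_measurable borel"
    unfolding W_def[abs_def] using a holomorphic_on_imp_continuous_on[OF holo]
    by (intro moebius_integral_measurable) (auto intro!: continuous_intros)
  have "moebius_integral p a (\<lambda>z. (cmod (deriv u z))\<^sup>2 * (1 - (cmod z)\<^sup>2)\<^sup>2) \<le> (\<integral>\<^sup>+z. \<integral>\<^sup>+x. H z x \<partial>lborel \<partial>lborel)"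
    unfolding moebius_integral_def
  proof (rule nn_integral_mono)
    fix z :: complex
    show "indicator unit_disk z * ennreal ((cmod (deriv u z))\<^sup>2 * (1 - (cmod z)\<^sup>2)\<^sup>2 * moebius_kernel p a z) \<le> (\<integral>\<^sup>+x. H z x \<partial>lborel)"
    proof (cases "z \<in> unit_disk")
      case True
      then have z: "cmod z < 1" by simp
      define r where "r = (1 - cmod z) / 4"
      have r: "0 < r" "1 - cmod z = 4 * r" using z by (auto simp: r_def)
      have sub: "ball z (2 * r) \<subseteq> unit_disk"
      proof
        fix y assume "y \<in> ball z (2 * r)"
        then show "y \<in> unit_disk" using norm_triangle_ineq2[of y z] r by (simp add: dist_norm norm_minus_commute)
      qed
      \<comment> \<open>Chosen so that multiplying the left side of \<open>area_deriv_bound\<close>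
        by \<open>m\<close> gives the integrand at \<open>z\<close>.\<close>
      define m where "m = (1 - (cmod z)\<^sup>2)\<^sup>2 * moebius_kernel p a z / (pi * r ^ 4)"
      have m0: "0 \<le> m" by (simp add: m_def moebius_kernel_nonneg)
      have "(1 - (cmod z)\<^sup>2)\<^sup>2 \<le> 64 * r\<^sup>2"
        using one_minus_norm_sq_bound[OF z] r by (simp add: power_mult_distrib)
      then have "m \<le> 64 * r\<^sup>2 * moebius_kernel p a z / (pi * r ^ 4)"
        unfolding m_def using r by (intro divide_right_mono mult_right_mono moebius_kernel_nonneg) auto
      also have "\<dots> = 64 * moebius_kernel p a z / (pi * r\<^sup>2)"
        using r by (simp add: power2_eq_square power4_eq_xxxx)
      finally have m: "m \<le> 64 * moebius_kernel p a z / (pi * r\<^sup>2)" .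
      have "ennreal ((cmod (deriv u z))\<^sup>2 * (1 - (cmod z)\<^sup>2)\<^sup>2 * moebius_kernel p a z) = ennreal m * ennreal ((cmod (deriv u z))\<^sup>2 * (pi * r ^ 4))"
        using r m0 by (subst ennreal_mult[symmetric]) (auto simp: m_def mult_ac)
      also have "\<dots> \<le> ennreal m * (\<integral>\<^sup>+x. indicator (ball z (2 * r)) x * ennreal ((cmod (u x))\<^sup>2) \<partial>lborel)"
        by (intro mult_left_mono area_deriv_bound holomorphic_on_subset[OF holo sub] r) simp
      also have "\<dots> = (\<integral>\<^sup>+x. ennreal m * (indicator (ball z (2 * r)) x * ennreal ((cmod (u x))\<^sup>2)) \<partial>lborel)"
      proof (rule nn_integral_cmult[symmetric])
        have "(\<lambda>x. indicator (ball z (2 * r)) x * ennreal ((cmod (u x))\<^sup>2)) \<in> borel_measurable borel"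
          using holomorphic_on_imp_continuous_on[OF holomorphic_on_subset[OF holo sub]]
          by (intro borel_measurable_indicator_continuous_on) (auto intro!: continuous_intros)
        then show "(\<lambda>x. indicator (ball z (2 * r)) x * ennreal ((cmod (u x))\<^sup>2)) \<in> borel_measurable lborel" by simp
      qed
      also have "\<dots> \<le> (\<integral>\<^sup>+x. H z x \<partial>lborel)"
      proof (rule nn_integral_mono)
        fix x
        show "ennreal m * (indicator (ball z (2 * r)) x * ennreal ((cmod (u x))\<^sup>2)) \<le> H z x"
        proof (cases "x \<in> ball z (2 * r)")
          case True
          then have d: "cmod (x - z) < 2 * r" by (simp add: dist_norm norm_minus_commute)
          have x: "1 - cmod x > 2 * r" using d r norm_triangle_ineq2[of x z] by argo
          have x': "1 - cmod x \<le> 8 * r" using d r norm_triangle_ineq2[of z x] by (simp add: norm_minus_commute)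
          have "(1 - cmod x)\<^sup>2 \<le> (8 * r)\<^sup>2" using x x' r by (intro power_mono) auto
          then have "inverse (64 * r\<^sup>2) \<le> inverse ((1 - cmod x)\<^sup>2)"
            using x r by (intro le_imp_inverse_le) (auto simp: power_mult_distrib)
          then have i: "inverse (r\<^sup>2) \<le> 64 * inverse ((1 - cmod x)\<^sup>2)" by simp
          have k: "moebius_kernel p a z \<le> 16 powr p * moebius_kernel p a x"
            by (rule moebius_kernel_harnack[OF p a z]) (use d r in argo)
          have "m \<le> 64 / pi * (moebius_kernel p a z * inverse (r\<^sup>2))"
            using m by (simp add: field_simps)
          also have "\<dots> \<le> 64 / pi * ((16 powr p * moebius_kernel p a x) * (64 * inverse ((1 - cmod x)\<^sup>2)))"
            by (intro mult_left_mono mult_mono k i) (auto simp: moebius_kernel_nonneg)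
          also have "\<dots> = c * inverse ((1 - cmod x)\<^sup>2) * moebius_kernel p a x"
            by (simp add: c_def)
          finally have "m * (cmod (u x))\<^sup>2 \<le> c * inverse ((1 - cmod x)\<^sup>2) * moebius_kernel p a x * (cmod (u x))\<^sup>2"
            by (rule mult_right_mono) simp
          then show ?thesis
            using True sub m0 d x by (auto simp: H_def W_def indicator_def ennreal_mult[symmetric] mult_ac intro!: ennreal_leI)
        qed simp
      qed
      finally show ?thesis using True by simp
    qed simp
  qed
  also have "\<dots> = (\<integral>\<^sup>+x. \<integral>\<^sup>+z. H z x \<partial>lborel \<partial>lborel)"
    unfolding H_def by (rule lborel_pair.Fubini') measurable
  also have "\<dots> = moebius_integral p a (\<lambda>z. 4096 * 16 powr p * (cmod (u z))\<^sup>2)"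
    unfolding moebius_integral_def
  proof (rule nn_integral_cong)
    fix x
    have "(\<integral>\<^sup>+z. H z x \<partial>lborel) = (\<integral>\<^sup>+z. W x * indicator (ball x (1 - cmod x)) z \<partial>lborel)"
      by (intro nn_integral_cong) (auto simp: H_def indicator_def dist_norm)
    also have "\<dots> = W x * emeasure lborel (ball x (1 - cmod x))"
      by (rule nn_integral_cmult_indicator) simp
    also have "\<dots> = indicator unit_disk x * ennreal (4096 * 16 powr p * (cmod (u x))\<^sup>2 * moebius_kernel p a x)"
    proof (cases "x \<in> unit_disk")
      case True
      then have "1 - cmod x > 0" by simp
      then show ?thesis using True c
        by (simp add: W_def emeasure_ball unit_ball_vol_2 ennreal_mult[symmetric] moebius_kernel_nonneg) (simp add: c_def field_simps)
    qed (simp add: W_def)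
    finally show "(\<integral>\<^sup>+z. H z x \<partial>lborel) = indicator unit_disk x * ennreal (4096 * 16 powr p * (cmod (u x))\<^sup>2 * moebius_kernel p a x)" .
  qed
  also have "\<dots> = ennreal (4096 * 16 powr p) * moebius_integral p a (\<lambda>z. (cmod (u z))\<^sup>2)"
    by (rule moebius_integral_cmult) (auto intro!: a continuous_intros holomorphic_on_imp_continuous_on holo)
  finally show ?thesis .
qed

text \<open>Close to the boundary the integral is below 1 by hypothesis. All remaining centres have
  modulus at most \<open>s\<close>, and their kernels are dominated, uniformly in the point, by a
  multiple of the kernel of one fixed centre \<open>b\<close> that is itself close to the
  boundary.\<close>

lemma moebius_integral_bounded:
  assumes p: "0 < p" and tz: "tends_zero_at_boundary (\<lambda>a. moebius_integral p a q)"
    and q: "continuous_on unit_disk q"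
  shows "\<exists>B\<ge>0. \<forall>a\<in>unit_disk. moebius_integral p a q \<le> ennreal B"
proof -
  obtain r where r: "r < 1" "\<And>a. a \<in> unit_disk \<Longrightarrow> r < cmod a \<Longrightarrow> moebius_integral p a q < ennreal 1"
    using tz unfolding tends_zero_at_boundary_def by (meson zero_less_one)
  \<comment> \<open>Strictly between \<open>r\<close> and 1; the maximum covers a negative
    \<open>r\<close>.\<close>
  define s where "s = (1 + max r 0) / 2"
  have s: "r < s" "0 < s" "s < 1" using r by (auto simp: s_def max_def)
  define b where "b = complex_of_real s"
  have b: "cmod b = s" using s by (simp add: b_def)
  then have bd: "moebius_integral p b q < ennreal 1" using s by (intro r) auto
  \<comment> \<open>For |z| < 1, |a| at most \<open>s\<close> and |b| = \<open>s\<close>: 4 bounds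
    |1 - cnj b z|^2 above, \<open>(1 - s)\<^sup>2\<close> bounds |1 - cnj a z|^2 below, and
    \<open>1 - s\<^sup>2\<close> is 1 - |b|^2.\<close>
  define C where "C = 4 / ((1 - s)\<^sup>2 * (1 - s\<^sup>2))"
  have s2: "0 < 1 - s\<^sup>2" using s by (simp add: abs_square_less_1)
  have C: "0 \<le> C" using s2 by (simp add: C_def)
  have "moebius_integral p a q \<le> ennreal (1 + C powr p)" if a: "a \<in> unit_disk" for a
  proof (cases "r < cmod a")
    case True
    then have "moebius_integral p a q \<le> ennreal 1" using r a by (intro less_imp_le) auto
    also have "\<dots> \<le> ennreal (1 + C powr p)" by (intro ennreal_leI) simp
    finally show ?thesis .
  next
    case False
    then have as: "cmod a \<le> s" using s by simp
    have a1: "cmod a < 1" using a by simp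
    have "moebius_kernel p a z \<le> C powr p * moebius_kernel p b z" if "z \<in> unit_disk" for z
    proof (rule moebius_kernel_le[OF p C])
      have z: "cmod z < 1" using that by simp
      let ?A = "cmod (1 - cnj a * z)" and ?B = "cmod (1 - cnj b * z)"
      have z2: "0 \<le> 1 - (cmod z)\<^sup>2" using z by (simp add: abs_square_le_1)
      have az: "cmod a * cmod z \<le> s * 1" using as z s by (intro mult_mono) auto
      have "1 - s \<le> ?A" using az norm_triangle_ineq2[of 1 "cnj a * z"] by (simp add: norm_mult)
      then have A: "(1 - s)\<^sup>2 \<le> ?A\<^sup>2" using s by (intro power_mono) auto
      have bz: "cmod b * cmod z \<le> 1 * 1" using b z s by (intro mult_mono) auto
      have "?B \<le> 2" using bz norm_triangle_ineq4[of 1 "cnj b * z"] by (simp add: norm_mult)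
      then have "?B\<^sup>2 \<le> 2\<^sup>2" by (intro power_mono) auto
      then have B: "?B\<^sup>2 \<le> 4" by simp
      have B0: "0 < ?B" using one_minus_cnj_mult_nonzero[of b z] b s z by simp
      have "1 - (cmod (disk_auto a z))\<^sup>2 = (1 - (cmod a)\<^sup>2) * (1 - (cmod z)\<^sup>2) / ?A\<^sup>2"
        using a1 z by (rule one_minus_norm_disk_auto)
      also have "\<dots> \<le> 1 * (1 - (cmod z)\<^sup>2) / (1 - s)\<^sup>2"
        using A s z2 by (intro frac_le mult_right_mono) auto
      also have "\<dots> = C * ((1 - s\<^sup>2) * (1 - (cmod z)\<^sup>2) / 4)"
      proof -
        have "1 * x / t = 4 / (t * y) * (y * x / 4)" if "y \<noteq> 0" for x t y :: real using that by simp
        moreover have "1 - s\<^sup>2 \<noteq> 0" using s2 by simp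
        ultimately show ?thesis unfolding C_def by blast
      qed
      also have "\<dots> \<le> C * ((1 - s\<^sup>2) * (1 - (cmod z)\<^sup>2) / ?B\<^sup>2)"
        using B B0 s2 z2 C by (intro mult_left_mono divide_left_mono mult_nonneg_nonneg) auto
      also have "(1 - s\<^sup>2) * (1 - (cmod z)\<^sup>2) / ?B\<^sup>2 = 1 - (cmod (disk_auto b z))\<^sup>2"
        using one_minus_norm_disk_auto[of b z] b s z by simp
      finally show "1 - (cmod (disk_auto a z))\<^sup>2 \<le> C * (1 - (cmod (disk_auto b z))\<^sup>2)" .
    qed (use a1 that b s in auto)
    note le = this
    have "moebius_integral p a q \<le> moebius_integral p b (\<lambda>z. C powr p * q z)"
      unfolding moebius_integral_def
    proof (rule nn_integral_mono)
      fix z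
      show "indicator unit_disk z * ennreal (q z * moebius_kernel p a z) \<le> indicator unit_disk z * ennreal (C powr p * q z * moebius_kernel p b z)"
      proof (cases "z \<in> unit_disk \<and> 0 \<le> q z")
        case True
        with mult_left_mono[OF le[of z], of "q z"] show ?thesis
          by (auto simp: mult_ac intro!: ennreal_leI)
      next
        case False
        \<comment> \<open>Negative values of \<open>q\<close> are cut to 0 by
          \<open>ennreal\<close>.\<close>
        then have "z \<notin> unit_disk \<or> q z * moebius_kernel p a z \<le> 0"
          using moebius_kernel_nonneg[of p a z] by (auto simp: mult_nonpos_nonneg)
        then show ?thesis by (auto simp: ennreal_neg)
      qed
    qed
    also have "\<dots> = ennreal (C powr p) * moebius_integral p b q"
      by (rule moebius_integral_cmult) (use b s q in auto)
    also have "\<dots> \<le> ennreal (C powr p) * ennreal 1"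
      using bd by (intro mult_left_mono) auto
    also have "\<dots> \<le> ennreal (1 + C powr p)" by (simp add: ennreal_leI del: ennreal_plus)
    finally show ?thesis .
  qed
  then show ?thesis by (intro exI[of _ "1 + C powr p"]) auto
qed

text \<open>A squeeze with two majorants, since the later estimates combine one integral for the
  dilatation with one for another function.\<close>

lemma tends_zero_at_boundary_mono:
  assumes J: "tends_zero_at_boundary J" and J': "tends_zero_at_boundary J'" and C: "0 \<le> C"
    and le: "\<And>a. a \<in> unit_disk \<Longrightarrow> I a \<le> ennreal C * (J a + J' a)"
  shows "tends_zero_at_boundary I"
  unfolding tends_zero_at_boundary_def
proof (intro allI impI)
  fix e :: real assume e: "0 < e"
  \<comment> \<open>The \<open>+ 1\<close> keeps the denominator positive and the final inequality
    strict even when \<open>C\<close> is 0.\<close>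
  define d where "d = e / (2 * (C + 1))"
  have d: "0 < d" using e C by (simp add: d_def)
  obtain r where r: "r < 1" "\<And>a. a \<in> unit_disk \<Longrightarrow> r < cmod a \<Longrightarrow> J a < ennreal d"
    using J d unfolding tends_zero_at_boundary_def by meson
  obtain r' where r': "r' < 1" "\<And>a. a \<in> unit_disk \<Longrightarrow> r' < cmod a \<Longrightarrow> J' a < ennreal d"
    using J' d unfolding tends_zero_at_boundary_def by meson
  have "I a < ennreal e" if a: "a \<in> unit_disk" "max r r' < cmod a" for a
  proof -
    have "I a \<le> ennreal C * (J a + J' a)" by (rule le[OF a(1)])
    also have "\<dots> \<le> ennreal C * (ennreal d + ennreal d)"
      using r(2)[of a] r'(2)[of a] a by (intro mult_left_mono add_mono) (auto intro: less_imp_le)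
    also have "\<dots> = ennreal C * ennreal (d + d)" using d by (subst ennreal_plus) auto
    also have "\<dots> = ennreal (C * (d + d))" using C d by (intro ennreal_mult[symmetric]) auto
    also have "\<dots> < ennreal e"
    proof (rule ennreal_lessI[OF e])
      have "C * (d + d) < (C + 1) * (d + d)" using d by (intro mult_strict_right_mono) auto
      also have "\<dots> = d * (2 * (C + 1))" by simp
      also have "\<dots> = e" using C by (simp add: d_def)
      finally show "C * (d + d) < e" .
    qed
    finally show ?thesis .
  qed
  then show "\<exists>r<1. \<forall>a\<in>unit_disk. r < cmod a \<longrightarrow> I a < ennreal e"
    using r(1) r'(1) by (intro exI[of _ "max r r'"]) auto
qed


section \<open>Wirtinger derivatives of the logarithm of the Jacobian\<close>

text \<open>The directions 1 and \<open>\<i>\<close> give the partial derivatives A + B and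
  \<open>\<i>\<close> (A - B), and \<open>dz\<close> extracts A. One real Frechet derivative thus
  replaces separate partial derivatives.\<close>

lemma dz_eqI:
  assumes "(G has_derivative (\<lambda>v. A * v + B * cnj v)) (at z)"
  shows "dz G z = A"
proof -
  have dir: "((\<lambda>t::real. G (z + c * of_real t)) has_vector_derivative (A * c + B * cnj c)) (at 0)" for c
  proof -
    have "((\<lambda>t::real. z + c * of_real t) has_derivative (\<lambda>t. c * of_real t)) (at 0)"
      by (auto intro!: derivative_eq_intros)
    moreover have "(G has_derivative (\<lambda>v. A * v + B * cnj v)) (at (z + c * of_real 0))" using assms by simp
    ultimately have "((\<lambda>t::real. G (z + c * of_real t)) has_derivative (\<lambda>t. A * (c * of_real t) + B * cnj (c * of_real t))) (at 0)"
      by (rule has_derivative_compose)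
    then show ?thesis
      by (simp add: has_vector_derivative_def scaleR_conv_of_real algebra_simps)
  qed
  have 1: "pdx G z = A + B"
    unfolding pdx_def using vector_derivative_at[OF dir[of 1]] by simp
  have 2: "pdy G z = A * \<i> - B * \<i>"
    unfolding pdy_def using vector_derivative_at[OF dir[of \<i>]] by simp
  show ?thesis unfolding dz_def 1 2 by (simp add: algebra_simps)
qed

text \<open>Closed formulas are available on the disk only; openness suffices for differentiating
  them.\<close>

lemma dz_cong:
  assumes "open S" "z \<in> S" "\<And>x. x \<in> S \<Longrightarrow> G x = G' x"
    and "(G' has_derivative (\<lambda>v. A * v + B * cnj v)) (at z)"
  shows "dz G z = A"
  by (rule dz_eqI, rule has_derivative_transform_within_open[OF assms(4,1,2)]) (use assms(3) in auto)

text \<open>The function is real, so the coefficients of \<open>v\<close> and \<open>cnj v\<close>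
  are conjugate. In the first of them, \<open>H' / H z\<close> stems from log |H|^2 and the other
  term from log (1 - |W|^2). With H = h' and W = w it is F_z.\<close>

lemma has_derivative_log_density:
  assumes H: "(H has_field_derivative H') (at z)" and W: "(W has_field_derivative W') (at z)"
    and nz: "H z \<noteq> 0" and w1: "cmod (W z) < 1"
  shows "((\<lambda>x. complex_of_real (ln ((cmod (H x))\<^sup>2 * (1 - (cmod (W x))\<^sup>2)))) has_derivative
     (\<lambda>v. (H' / H z - W' * cnj (W z) / (1 - W z * cnj (W z))) * v
        + cnj (H' / H z - W' * cnj (W z) / (1 - W z * cnj (W z))) * cnj v)) (at z)"
proof -
  let ?m = "1 - (cmod (W z))\<^sup>2"
  let ?A = "H' / H z - W' * cnj (W z) / (1 - W z * cnj (W z))"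
  have m: "0 < ?m" using w1 by (simp add: abs_square_less_1)
  have mc: "1 - W z * cnj (W z) = of_real ?m" by (simp only: of_real_diff of_real_1 complex_norm_square)
  have n: "0 < (cmod (H z))\<^sup>2" using nz by simp
  have sq: "((\<lambda>x. (cmod (f x))\<^sup>2) has_derivative (\<lambda>v. 2 * Re (cnj (f z) * (f' * v)))) (at z)"
    if "(f has_field_derivative f') (at z)" for f f'
  proof -
    have "(f has_derivative (\<lambda>v. f' * v)) (at z)" using that by (simp add: has_field_derivative_def)
    then have "((\<lambda>x. f x \<bullet> f x) has_derivative (\<lambda>v. f z \<bullet> (f' * v) + (f' * v) \<bullet> f z)) (at z)"
      by (rule has_derivative_inner[rotated]) fact
    then show ?thesis
      by (simp add: power2_norm_eq_inner inner_complex_def algebra_simps)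
  qed
  have "((\<lambda>x. ln ((cmod (H x))\<^sup>2 * (1 - (cmod (W x))\<^sup>2))) has_derivative
     (\<lambda>v. (2 * Re (cnj (H z) * (H' * v)) * ?m - (cmod (H z))\<^sup>2 * (2 * Re (cnj (W z) * (W' * v)))) / ((cmod (H z))\<^sup>2 * ?m))) (at z)"
  proof -
    have "((\<lambda>x. (cmod (H x))\<^sup>2 * (1 - (cmod (W x))\<^sup>2)) has_derivative
       (\<lambda>v. (cmod (H z))\<^sup>2 * (0 - 2 * Re (cnj (W z) * (W' * v))) + 2 * Re (cnj (H z) * (H' * v)) * ?m)) (at z)"
      by (intro has_derivative_mult has_derivative_diff has_derivative_const sq H W)
    then have "((\<lambda>x. ln ((cmod (H x))\<^sup>2 * (1 - (cmod (W x))\<^sup>2))) has_derivative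
       (\<lambda>v. ((cmod (H z))\<^sup>2 * (0 - 2 * Re (cnj (W z) * (W' * v))) + 2 * Re (cnj (H z) * (H' * v)) * ?m)
         * inverse ((cmod (H z))\<^sup>2 * ?m))) (at z)"
      by (rule has_derivative_ln[rotated]) (use n m in simp)
    moreover have "(x * (0 - y) + u * t) * inverse w = (u * t - x * y) / w" for x y u t w :: real
      by (simp add: divide_inverse algebra_simps)
    ultimately show ?thesis by (simp only:)
  qed
  then have "((\<lambda>x. complex_of_real (ln ((cmod (H x))\<^sup>2 * (1 - (cmod (W x))\<^sup>2)))) has_derivative
     (\<lambda>v. complex_of_real ((2 * Re (cnj (H z) * (H' * v)) * ?m - (cmod (H z))\<^sup>2 * (2 * Re (cnj (W z) * (W' * v)))) / ((cmod (H z))\<^sup>2 * ?m)))) (at z)"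
    by (rule has_derivative_of_real)
  moreover have "complex_of_real ((2 * Re (cnj (H z) * (H' * v)) * ?m - (cmod (H z))\<^sup>2 * (2 * Re (cnj (W z) * (W' * v)))) / ((cmod (H z))\<^sup>2 * ?m))
     = ?A * v + cnj ?A * cnj v" for v
  proof -
    have re: "complex_of_real (2 * Re x) = x + cnj x" for x by (simp add: complex_add_cnj)
    have "(2 * Re (cnj (H z) * (H' * v)) * ?m - (cmod (H z))\<^sup>2 * (2 * Re (cnj (W z) * (W' * v)))) / ((cmod (H z))\<^sup>2 * ?m)
      = 2 * Re (cnj (H z) * (H' * v)) / (cmod (H z))\<^sup>2 - 2 * Re (cnj (W z) * (W' * v)) / ?m"
    proof -
      have "(x * a - b * y) / (b * a) = x / b - y / a" if "a \<noteq> 0" "b \<noteq> 0" for x y a b :: real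
        using that by (simp add: field_simps)
      then show ?thesis using n m by simp
    qed
    also have "complex_of_real \<dots> = (cnj (H z) * (H' * v) + cnj (cnj (H z) * (H' * v))) / (H z * cnj (H z))
       - (cnj (W z) * (W' * v) + cnj (cnj (W z) * (W' * v))) / of_real ?m"
      by (simp only: of_real_diff of_real_divide re complex_norm_square)
    also have "\<dots> = ?A * v + cnj ?A * cnj v"
    proof -
      \<comment> \<open>Conjugates are replaced by independent letters, leaving a pure field
        identity.\<close>
      have "(h' * (a * v) + h * (a' * v')) / (h * h') - (w' * (b * v) + w * (b' * v')) / n
         = (a / h - b * w' / n) * v + (a' / h' - b' * w / n) * v'"
        if "h \<noteq> 0" "h' \<noteq> 0" "n \<noteq> 0" for h h' a a' b b' v v' w w' n :: complex
        using that by (simp add: field_simps)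
      moreover have "cnj (H z) \<noteq> 0" "complex_of_real ?m \<noteq> 0" using nz m by (simp, subst of_real_eq_0_iff, simp)
      ultimately show ?thesis
        unfolding mc complex_cnj_diff complex_cnj_divide complex_cnj_mult complex_cnj_cnj complex_cnj_complex_of_real
        using nz by blast
    qed
    finally show ?thesis .
  qed
  ultimately show ?thesis by simp
qed

text \<open>For the z-derivative cnj w is constant, so \<open>c\<close> has z-derivative w' c^2 and
  w' c has w'' c + (w' c)^2. Only the coefficient of \<open>v\<close> enters F_zz, hence
  \<open>B\<close> stays existential.\<close>

lemma has_derivative_prelog:
  assumes P: "(P has_field_derivative P') (at z)" and W: "(W has_field_derivative W1 z) (at z)"
    and W1: "(W1 has_field_derivative W2) (at z)" and w1: "cmod (W z) < 1"
  defines "c \<equiv> cnj (W z) / (1 - W z * cnj (W z))"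
  shows "\<exists>B. ((\<lambda>x. P x - W1 x * cnj (W x) / (1 - W x * cnj (W x))) has_derivative
     (\<lambda>v. (P' - W2 * c - (W1 z * c)\<^sup>2) * v + B * cnj v)) (at z)"
proof -
  let ?m = "1 - W z * cnj (W z)"
  have "(cmod (W z))\<^sup>2 < 1" using w1 by (simp add: abs_square_less_1)
  then have m: "?m \<noteq> 0" by (metis complex_norm_square eq_iff_diff_eq_0 less_irrefl of_real_eq_1_iff)
  have dP: "(P has_derivative (\<lambda>v. P' * v)) (at z)" and dW: "(W has_derivative (\<lambda>v. W1 z * v)) (at z)"
    and dW1: "(W1 has_derivative (\<lambda>v. W2 * v)) (at z)"
    using P W W1 by (simp_all add: has_field_derivative_def)
  have dcW: "((\<lambda>x. cnj (W x)) has_derivative (\<lambda>v. cnj (W1 z * v))) (at z)"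
    by (rule has_derivative_cnj[OF dW])
  have "((\<lambda>x. P x - W1 x * cnj (W x) / (1 - W x * cnj (W x))) has_derivative
     (\<lambda>v. P' * v - ((W1 z * cnj (W1 z * v) + W2 * v * cnj (W z)) * ?m
        + W1 z * cnj (W z) * (W z * cnj (W1 z * v) + W1 z * v * cnj (W z))) / (?m * ?m))) (at z)"
    using m by (auto intro!: derivative_eq_intros dP dW dW1 dcW simp: algebra_simps)
  moreover have "P' * v - ((W1 z * cnj (W1 z * v) + W2 * v * cnj (W z)) * ?m
        + W1 z * cnj (W z) * (W z * cnj (W1 z * v) + W1 z * v * cnj (W z))) / (?m * ?m)
      = (P' - W2 * c - (W1 z * c)\<^sup>2) * v + (- W1 z * cnj (W1 z) / ?m - W1 z * cnj (W z) * W z * cnj (W1 z) / (?m * ?m)) * cnj v" for v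
  proof -
    have "k * v - ((a * (a' * v') + d * v * b) * n + a * b * (w * (a' * v') + a * v * b)) / (n * n)
      = (k - d * (b / n) - (a * (b / n))\<^sup>2) * v + (- a * a' / n - a * b * w * a' / (n * n)) * v'"
      if "n \<noteq> 0" for k v a a' v' d b n w :: complex
      using that by (simp add: field_simps power2_eq_square)
    then show ?thesis unfolding c_def complex_cnj_mult using m by blast
  qed
  ultimately show ?thesis by auto
qed


section \<open>Pointwise size of the Schwarzian and rewriting of the Carleson integral\<close>

text \<open>\<open>S\<close> is F_zz - F_z^2 / 2 with a = w' and b = w''. Expanding the square
  leaves one mixed term, which is absorbed into the pure squares; a sum of four terms is then
  squared at the cost of a factor 4.\<close>

lemma norm_schwarzian_combination:
  fixes P P' a b c :: complex
  assumes c: "cmod c \<le> k"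
  defines "S \<equiv> P' - b * c - (a * c)\<^sup>2 - (P - a * c)\<^sup>2 / 2"
  shows "(cmod S)\<^sup>2 \<le> 4 * (cmod P')\<^sup>2 + 4 * k\<^sup>2 * (cmod b)\<^sup>2 + 16 * k ^ 4 * (cmod a) ^ 4 + 4 * (cmod P) ^ 4"
proof -
  have k: "0 \<le> k" using c norm_ge_zero[of c] by linarith
  define y where "y = cmod (a * c)"
  have y: "0 \<le> y" "y \<le> k * cmod a" using mult_left_mono[OF c, of "cmod a"] by (auto simp: y_def norm_mult mult_ac)
  have bc: "cmod (b * c) \<le> k * cmod b" using mult_left_mono[OF c, of "cmod b"] by (simp add: norm_mult mult_ac)
  have "S = P' - b * c - 3 / 2 * (a * c)\<^sup>2 - P\<^sup>2 / 2 + P * (a * c)"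
    by (simp add: S_def power2_eq_square field_simps)
  also have "cmod \<dots> \<le> cmod (P' - b * c - 3 / 2 * (a * c)\<^sup>2 - P\<^sup>2 / 2) + cmod (P * (a * c))"
    by (rule norm_triangle_ineq)
  also have "\<dots> \<le> cmod (P' - b * c - 3 / 2 * (a * c)\<^sup>2) + cmod (P\<^sup>2 / 2) + cmod (P * (a * c))"
    by (intro add_right_mono norm_triangle_ineq4)
  also have "\<dots> \<le> cmod (P' - b * c) + cmod (3 / 2 * (a * c)\<^sup>2) + cmod (P\<^sup>2 / 2) + cmod (P * (a * c))"
    by (intro add_right_mono norm_triangle_ineq4)
  also have "\<dots> \<le> cmod P' + cmod (b * c) + cmod (3 / 2 * (a * c)\<^sup>2) + cmod (P\<^sup>2 / 2) + cmod (P * (a * c))"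
    by (intro add_right_mono norm_triangle_ineq4)
  also have "\<dots> = cmod P' + cmod (b * c) + 3 / 2 * y\<^sup>2 + (cmod P)\<^sup>2 / 2 + cmod P * y"
  proof -
    have "cmod (3 / 2 * (a * c)\<^sup>2) = 3 / 2 * y\<^sup>2" unfolding y_def norm_mult norm_power norm_divide by simp
    moreover have "cmod (P\<^sup>2 / 2) = (cmod P)\<^sup>2 / 2" unfolding norm_power norm_divide by simp
    moreover have "cmod (P * (a * c)) = cmod P * y" unfolding y_def by (rule norm_mult)
    ultimately show ?thesis by simp
  qed
  \<comment> \<open>\<open>cmod P * y\<close> is at most half the sum of the two squares, which
    raises 3/2 to 2 and 1/2 to 1.\<close>
  also have "\<dots> \<le> cmod P' + k * cmod b + 2 * y\<^sup>2 + (cmod P)\<^sup>2"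
    using bc zero_le_power2[of "cmod P - y"] unfolding power2_diff by argo
  also have "\<dots> \<le> cmod P' + k * cmod b + 2 * (k * cmod a)\<^sup>2 + (cmod P)\<^sup>2"
    using y power_mono[of y "k * cmod a" 2] by simp
  finally have "(cmod S)\<^sup>2 \<le> (cmod P' + k * cmod b + 2 * (k * cmod a)\<^sup>2 + (cmod P)\<^sup>2)\<^sup>2"
    by (intro power_mono) auto
  also have "\<dots> \<le> 4 * ((cmod P')\<^sup>2 + (k * cmod b)\<^sup>2 + (2 * (k * cmod a)\<^sup>2)\<^sup>2 + ((cmod P)\<^sup>2)\<^sup>2)"
  proof -
    have "(x1 + x2 + x3 + x4)\<^sup>2 \<le> 4 * (x1\<^sup>2 + x2\<^sup>2 + x3\<^sup>2 + x4\<^sup>2)" for x1 x2 x3 x4 :: real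
      using sum_squares_ge_zero[of "x1 - x2" "x1 - x3"] sum_squares_ge_zero[of "x1 - x4" "x2 - x3"]
        sum_squares_ge_zero[of "x2 - x4" "x3 - x4"]
      by (simp add: power2_eq_square algebra_simps)
    then show ?thesis by blast
  qed
  also have "\<dots> = 4 * (cmod P')\<^sup>2 + 4 * k\<^sup>2 * (cmod b)\<^sup>2 + 16 * k ^ 4 * (cmod a) ^ 4 + 4 * (cmod P) ^ 4"
    by (simp add: power_mult_distrib flip: power_mult)
  finally show ?thesis .
qed

text \<open>Of the weight exponent 2 + p, the part p joins |\<phi>_a'|^p to form the kernel and the
  square remains.\<close>

lemma nn_integral_disk_auto_density:
  assumes a: "a \<in> unit_disk" and p: "0 < p" and q: "continuous_on unit_disk q" "\<And>z. 0 \<le> q z"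
  shows "(\<integral>\<^sup>+ z. ennreal ((cmod (deriv (disk_auto a) z)) powr p)
      \<partial>density lborel (\<lambda>z. indicator unit_disk z * ennreal (q z * (1 - (cmod z)\<^sup>2) powr (2 + p))))
    = moebius_integral p a (\<lambda>z. q z * (1 - (cmod z)\<^sup>2)\<^sup>2)"
proof -
  have a1: "cmod a < 1" using a by simp
  have der: "deriv (disk_auto a) z = (cnj a * a - 1) / (1 - cnj a * z)\<^sup>2" if "1 - cnj a * z \<noteq> 0" for z
    unfolding disk_auto_def
    by (rule DERIV_imp_deriv)
       (use that in \<open>auto intro!: derivative_eq_intros simp: power2_eq_square field_simps\<close>)
  \<comment> \<open>Measurability is required on the whole plane, including the pole
    \<open>1 / cnj a\<close>; \<open>d\<close> records whatever value arises from
    \<open>deriv\<close> there.\<close>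
  define d where "d = cmod (deriv (disk_auto a) (1 / cnj a)) powr p"
  have eq: "cmod (deriv (disk_auto a) z) powr p =
      (if 1 - cnj a * z = 0 then d else cmod ((cnj a * a - 1) / (1 - cnj a * z)\<^sup>2) powr p)" for z
  proof (cases "1 - cnj a * z = 0")
    case True
    then have "a \<noteq> 0" by auto
    with True have "z = 1 / cnj a" by (simp add: field_simps)
    with True show ?thesis by (simp add: d_def)
  qed (simp add: der)
  have m1: "(\<lambda>z. ennreal ((cmod (deriv (disk_auto a) z)) powr p)) \<in> borel_measurable lborel"
    unfolding eq by measurable
  have "1 - (cmod z)\<^sup>2 \<noteq> 0" if "z \<in> unit_disk" for z :: complex
  proof -
    have "(cmod z)\<^sup>2 < 1" using that by (simp add: abs_square_less_1)
    then show ?thesis by simp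
  qed
  then have m2: "(\<lambda>z. indicator unit_disk z * ennreal (q z * (1 - (cmod z)\<^sup>2) powr (2 + p))) \<in> borel_measurable lborel"
    using q(1) by (simp, intro borel_measurable_indicator_continuous_on) (auto intro!: continuous_intros)
  show ?thesis
    unfolding nn_integral_density[OF m2 m1] moebius_integral_def
  proof (rule nn_integral_cong)
    fix z :: complex
    show "indicator unit_disk z * ennreal (q z * (1 - (cmod z)\<^sup>2) powr (2 + p)) * ennreal (cmod (deriv (disk_auto a) z) powr p)
      = indicator unit_disk z * ennreal (q z * (1 - (cmod z)\<^sup>2)\<^sup>2 * moebius_kernel p a z)"
    proof (cases "z \<in> unit_disk")
      case True
      then have z: "cmod z < 1" by simp
      have nz: "1 - cnj a * z \<noteq> 0" using one_minus_cnj_mult_nonzero[of a z] a1 z by simp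
      have z2: "0 < 1 - (cmod z)\<^sup>2" using z by (simp add: abs_square_less_1)
      have "(cmod a)\<^sup>2 \<le> 1" using a1 by (simp add: abs_square_le_1)
      moreover have "cnj a * a - 1 = of_real ((cmod a)\<^sup>2 - 1)"
        by (simp only: of_real_diff of_real_1 complex_norm_square mult.commute)
      ultimately have na: "cmod (cnj a * a - 1) = 1 - (cmod a)\<^sup>2" by (simp only: norm_of_real)
      have "cmod (deriv (disk_auto a) z) * (1 - (cmod z)\<^sup>2) = 1 - (cmod (disk_auto a z))\<^sup>2"
        unfolding der[OF nz] one_minus_norm_disk_auto[OF a1 z] norm_divide norm_power na by simp
      then have "moebius_kernel p a z = cmod (deriv (disk_auto a) z) powr p * (1 - (cmod z)\<^sup>2) powr p"
        unfolding moebius_kernel_def by (metis powr_mult)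
      moreover have "(1 - (cmod z)\<^sup>2) powr (2 + p) = (1 - (cmod z)\<^sup>2)\<^sup>2 * (1 - (cmod z)\<^sup>2) powr p"
        using z2 by (simp add: powr_add)
      ultimately show ?thesis
        using q(2) True by (simp add: ennreal_mult[symmetric] mult_ac)
    qed simp
  qed
qed

section \<open>Decay of the kernel integrals of h'' / h' and of the Schwarzian\<close>

theorem theorem4:
  fixes p :: real and h g :: "complex \<Rightarrow> complex"
  assumes "0 < p"
    and "h holomorphic_on unit_disk" and "g holomorphic_on unit_disk"
    and "h 0 = 0" and "g 0 = 0"
    and "\<forall>z\<in>unit_disk. deriv h z \<noteq> 0"
    and "\<forall>z\<in>unit_disk. cmod (dilatation h g z) < 1"
    and "unif_locally_univalent (harm h g)"
    and "dilatation h g \<in> Qp0 p"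
    and "(SUP z\<in>unit_disk. cmod (dilatation h g z)) < 1"
    and "logJ h g \<in> Qtilde_p0 p"
  shows "vanishing_carleson p
           (density lborel (\<lambda>z. indicator unit_disk z *
              ennreal ((cmod (schwarzian h g z))\<^sup>2 * (1 - (cmod z)\<^sup>2) powr (2 + p))))"
proof -
  define w where "w = dilatation h g"
  define P where "P z = deriv (deriv h) z / deriv h z" for z
  define c where "c z = cnj (w z) / (1 - w z * cnj (w z))" for z
  define \<Phi> where "\<Phi> z = P z - deriv w z * cnj (w z) / (1 - w z * cnj (w z))" for z
  have \<Phi>c: "\<Phi> z = P z - deriv w z * c z" for z by (simp add: \<Phi>_def c_def)
  have hol: "deriv h holomorphic_on unit_disk" "w holomorphic_on unit_disk" "deriv w holomorphic_on unit_disk"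
    "deriv (deriv w) holomorphic_on unit_disk" "P holomorphic_on unit_disk" "deriv P holomorphic_on unit_disk"
  proof -
    show h': "deriv h holomorphic_on unit_disk" using assms(2) by (rule holomorphic_deriv) simp
    show w: "w holomorphic_on unit_disk" using assms(9) by (simp add: Qp0_def w_def)
    then show w': "deriv w holomorphic_on unit_disk" by (rule holomorphic_deriv) simp
    then show "deriv (deriv w) holomorphic_on unit_disk" by (rule holomorphic_deriv) simp
    show P: "P holomorphic_on unit_disk" unfolding P_def using assms(6)
      by (auto intro!: holomorphic_intros h' holomorphic_deriv[OF h'])
    then show "deriv P holomorphic_on unit_disk" by (rule holomorphic_deriv) simp
  qed
  note cont = hol[THEN holomorphic_on_imp_continuous_on]
  have w1: "cmod (w z) < 1" if "z \<in> unit_disk" for z using assms(7) that by (simp add: w_def)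
  have m0: "1 - w z * cnj (w z) \<noteq> 0" if "z \<in> unit_disk" for z
  proof -
    have "(cmod (w z))\<^sup>2 < 1" using w1[OF that] by (simp add: abs_square_less_1)
    then show ?thesis by (metis complex_norm_square eq_iff_diff_eq_0 less_irrefl of_real_eq_1_iff)
  qed
  have cont_c: "continuous_on unit_disk c"
    unfolding c_def[abs_def] using m0 by (auto intro!: continuous_intros cont)
  have cont_\<Phi>: "continuous_on unit_disk \<Phi>"
    unfolding \<Phi>c[abs_def] by (intro continuous_intros cont cont_c)
  have D: "(f has_field_derivative deriv f z) (at z)" if "f holomorphic_on unit_disk" "z \<in> unit_disk" for f z
    using that by (intro holomorphic_derivI) auto

  have logJ: "logJ h g z = complex_of_real (ln ((cmod (deriv h z))\<^sup>2 * (1 - (cmod (w z))\<^sup>2)))" if "z \<in> unit_disk" for z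
  proof -
    have "deriv g z = w z * deriv h z" using assms(6) that by (simp add: w_def dilatation_def)
    then show ?thesis by (simp add: logJ_def jacobian_def norm_mult power_mult_distrib algebra_simps)
  qed
  have dz1: "dz (logJ h g) z = \<Phi> z" if "z \<in> unit_disk" for z
    unfolding \<Phi>_def P_def
    by (rule dz_cong[OF open_ball that logJ has_derivative_log_density])
       (use that assms(6) w1 in \<open>auto intro!: D hol\<close>)
  have dz2: "dz (dz (logJ h g)) z = deriv P z - deriv (deriv w) z * c z - (deriv w z * c z)\<^sup>2" if z: "z \<in> unit_disk" for z
  proof -
    obtain B where "(\<Phi> has_derivative (\<lambda>v. (deriv P z - deriv (deriv w) z * c z - (deriv w z * c z)\<^sup>2) * v + B * cnj v)) (at z)"
      using has_derivative_prelog[OF D[OF hol(5) z] D[OF hol(2) z] D[OF hol(3) z] w1[OF z]]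
      unfolding c_def \<Phi>_def[abs_def] by blast
    then show ?thesis by (intro dz_cong[OF open_ball z dz1])
  qed
  define S where "S z = deriv P z - deriv (deriv w) z * c z - (deriv w z * c z)\<^sup>2 - (P z - deriv w z * c z)\<^sup>2 / 2" for z
  have S: "schwarzian h g z = S z" if "z \<in> unit_disk" for z
    using dz1[OF that] dz2[OF that] by (simp add: schwarzian_def S_def \<Phi>c)
  have cont_S: "continuous_on unit_disk S"
    unfolding S_def[abs_def] by (intro continuous_intros cont cont_c) auto

  define M where "M = (SUP z\<in>unit_disk. cmod (w z))"
  have M: "cmod (w z) \<le> M" if "z \<in> unit_disk" for z
    unfolding M_def using that w1 by (intro cSUP_upper bdd_aboveI2[of _ _ 1]) (auto intro: less_imp_le)
  have M1: "M < 1" using assms(10) by (simp add: M_def w_def)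
  have M0: "0 \<le> M" using order_trans[OF norm_ge_zero M[of 0]] by simp
  then have M2: "M\<^sup>2 < 1" using M1 by (simp add: abs_square_less_1)
  \<comment> \<open>Bounds |c|: its numerator is below 1 and its denominator is at least
    \<open>1 - M\<^sup>2\<close>. This is where the supremum of |w| being below 1 enters.\<close>
  define k where "k = 1 / (1 - M\<^sup>2)"
  have k: "0 \<le> k" using M2 by (simp add: k_def)
  have ck: "cmod (c z) \<le> k" if "z \<in> unit_disk" for z
  proof -
    have "(cmod (w z))\<^sup>2 \<le> M\<^sup>2" using M[OF that] by (intro power_mono) auto
    then have "1 - M\<^sup>2 \<le> \<bar>1 - (cmod (w z))\<^sup>2\<bar>" by simp
    moreover have "1 - w z * cnj (w z) = of_real (1 - (cmod (w z))\<^sup>2)"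
      by (simp only: of_real_diff of_real_1 complex_norm_square)
    ultimately have "1 - M\<^sup>2 \<le> cmod (1 - w z * cnj (w z))" by (simp only: norm_of_real)
    then show ?thesis unfolding c_def k_def norm_divide using M2 w1[OF that]
      by (intro frac_le) auto
  qed

  let ?I = "\<lambda>u a. moebius_integral p a (\<lambda>z. (cmod (u z))\<^sup>2)"
  have tw: "tends_zero_at_boundary (?I (deriv w))"
    using assms(9) by (simp add: Qp0_def moebius_integral_def moebius_kernel_def w_def)
  define J where "J a = moebius_integral p a (\<lambda>z. (cmod (dz (logJ h g) z) + cmod (dzbar (logJ h g) z))\<^sup>2)" for a
  have tJ: "tends_zero_at_boundary J"
    using assms(11) by (simp add: Qtilde_p0_def J_def[abs_def] moebius_integral_def moebius_kernel_def)
  have tP: "tends_zero_at_boundary (?I P)"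
  \<comment> \<open>P = \<Phi> + w' c together with (x + y)^2 \<le> 2 x^2 + 2 y^2 gives the
    coefficients 2 and \<open>2 * k\<^sup>2\<close>; their sum serves for both majorants.\<close>
  proof (rule tends_zero_at_boundary_mono[OF tJ tw, of "2 + 2 * k\<^sup>2"])
    fix a :: complex assume a: "a \<in> unit_disk"
    then have a1: "cmod a < 1" by simp
    have "?I P a \<le> moebius_integral p a (\<lambda>z. 2 * (cmod (\<Phi> z))\<^sup>2 + 2 * k\<^sup>2 * (cmod (deriv w z))\<^sup>2)"
    proof (rule moebius_integral_mono)
      fix z assume z: "z \<in> unit_disk"
      have "cmod (P z) \<le> cmod (\<Phi> z) + cmod (deriv w z * c z)"
        using norm_triangle_ineq[of "\<Phi> z" "deriv w z * c z"] by (simp add: \<Phi>c)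
      also have "\<dots> \<le> cmod (\<Phi> z) + k * cmod (deriv w z)"
        using mult_left_mono[OF ck[OF z], of "cmod (deriv w z)"] by (simp add: norm_mult mult_ac)
      finally have "(cmod (P z))\<^sup>2 \<le> (cmod (\<Phi> z) + k * cmod (deriv w z))\<^sup>2" by (intro power_mono) auto
      also have "\<dots> \<le> 2 * (cmod (\<Phi> z))\<^sup>2 + 2 * (k * cmod (deriv w z))\<^sup>2"
        using zero_le_power2[of "cmod (\<Phi> z) - k * cmod (deriv w z)"] unfolding power2_diff power2_sum by argo
      finally show "(cmod (P z))\<^sup>2 \<le> 2 * (cmod (\<Phi> z))\<^sup>2 + 2 * k\<^sup>2 * (cmod (deriv w z))\<^sup>2"
        by (simp add: power_mult_distrib)
    qed
    also have "\<dots> = moebius_integral p a (\<lambda>z. 2 * (cmod (\<Phi> z))\<^sup>2) + moebius_integral p a (\<lambda>z. 2 * k\<^sup>2 * (cmod (deriv w z))\<^sup>2)"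
      by (rule moebius_integral_add) (auto intro!: a1 continuous_intros cont cont_\<Phi>)
    also have "\<dots> = ennreal 2 * ?I \<Phi> a + ennreal (2 * k\<^sup>2) * ?I (deriv w) a"
      by (intro arg_cong2[of _ _ _ _ "(+)"] moebius_integral_cmult) (auto intro!: a1 continuous_intros cont cont_\<Phi>)
    also have "\<dots> \<le> ennreal (2 + 2 * k\<^sup>2) * J a + ennreal (2 + 2 * k\<^sup>2) * ?I (deriv w) a"
    proof (intro add_mono mult_mono ennreal_leI)
      show "?I \<Phi> a \<le> J a"
        unfolding J_def by (rule moebius_integral_mono) (auto simp: dz1 intro!: power_mono)
    qed auto
    finally show "?I P a \<le> ennreal (2 + 2 * k\<^sup>2) * (J a + ?I (deriv w) a)" by (simp only: distrib_left)
  qed simp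

  \<comment> \<open>Bloch-type growth: the pointwise estimate is used with the kernel centred at
    \<open>z\<close> itself, and the kernel integrals are bounded over all centres.\<close>
  have bloch: "\<exists>B\<ge>0. \<forall>z\<in>unit_disk. (cmod (u z))\<^sup>2 * (1 - (cmod z)\<^sup>2)\<^sup>2 \<le> B"
    if u: "u holomorphic_on unit_disk" and tu: "tends_zero_at_boundary (?I u)" for u
  proof -
    have "continuous_on unit_disk (\<lambda>z. (cmod (u z))\<^sup>2)"
      by (intro continuous_intros holomorphic_on_imp_continuous_on u)
    from moebius_integral_bounded[OF assms(1) tu this]
    obtain B where B: "0 \<le> B" "\<And>a. a \<in> unit_disk \<Longrightarrow> ?I u a \<le> ennreal B" by blast
    have "(cmod (u z))\<^sup>2 * (1 - (cmod z)\<^sup>2)\<^sup>2 \<le> 16 * 16 powr p * B" if "z \<in> unit_disk" for z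
    proof -
      have "ennreal ((cmod (u z))\<^sup>2 * (1 - (cmod z)\<^sup>2)\<^sup>2) \<le> ennreal (16 * 16 powr p) * ?I u z"
        using that by (intro moebius_integral_pointwise assms(1) u) simp
      also have "\<dots> \<le> ennreal (16 * 16 powr p) * ennreal B"
        using B that by (intro mult_left_mono) auto
      also have "\<dots> = ennreal (16 * 16 powr p * B)" using B(1) by (intro ennreal_mult[symmetric]) auto
      finally show ?thesis using B(1) by simp
    qed
    then show ?thesis using B(1) by (intro exI[of _ "16 * 16 powr p * B"]) auto
  qed
  obtain Bw where Bw: "0 \<le> Bw" "\<And>z. z \<in> unit_disk \<Longrightarrow> (cmod (deriv w z))\<^sup>2 * (1 - (cmod z)\<^sup>2)\<^sup>2 \<le> Bw"
    using bloch[OF hol(3) tw] by blast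
  obtain BP where BP: "0 \<le> BP" "\<And>z. z \<in> unit_disk \<Longrightarrow> (cmod (P z))\<^sup>2 * (1 - (cmod z)\<^sup>2)\<^sup>2 \<le> BP"
    using bloch[OF hol(5) tP] by blast

  define K where "K = 4096 * 16 powr p"
  have K: "0 \<le> K" by (simp add: K_def)
  \<comment> \<open>The total coefficient of the P-integral plus that of the w'-integral. The terms
    with \<open>K\<close> come from the derivatives P' and w'', those with \<open>BP\<close> and
    \<open>Bw\<close> from the fourth powers.\<close>
  define C where "C = 4 * K + 4 * BP + (4 * k\<^sup>2 * K + 16 * k ^ 4 * Bw)"
  have C: "0 \<le> C" using K k Bw BP by (simp add: C_def)
  let ?t = "\<lambda>z::complex. (1 - (cmod z)\<^sup>2)\<^sup>2"
  have main: "moebius_integral p a (\<lambda>z. (cmod (S z))\<^sup>2 * ?t z) \<le> ennreal C * (?I P a + ?I (deriv w) a)" if a: "a \<in> unit_disk" for a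
  proof -
    have a1: "cmod a < 1" using a by simp
    note ci = a1 continuous_intros cont
    have "moebius_integral p a (\<lambda>z. (cmod (S z))\<^sup>2 * ?t z) \<le> moebius_integral p a (\<lambda>z.
        (4 * ((cmod (deriv P z))\<^sup>2 * ?t z) + (4 * k\<^sup>2) * ((cmod (deriv (deriv w) z))\<^sup>2 * ?t z))
        + ((16 * k ^ 4 * Bw) * (cmod (deriv w z))\<^sup>2 + (4 * BP) * (cmod (P z))\<^sup>2))"
    proof (rule moebius_integral_mono)
      fix z assume z: "z \<in> unit_disk"
      have "(cmod (S z))\<^sup>2 * ?t z \<le> (4 * (cmod (deriv P z))\<^sup>2 + 4 * k\<^sup>2 * (cmod (deriv (deriv w) z))\<^sup>2
          + 16 * k ^ 4 * (cmod (deriv w z)) ^ 4 + 4 * (cmod (P z)) ^ 4) * ?t z"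
        unfolding S_def by (intro mult_right_mono norm_schwarzian_combination ck z) simp
      also have "\<dots> = (4 * ((cmod (deriv P z))\<^sup>2 * ?t z) + (4 * k\<^sup>2) * ((cmod (deriv (deriv w) z))\<^sup>2 * ?t z))
          + (16 * k ^ 4 * (cmod (deriv w z))\<^sup>2 * ((cmod (deriv w z))\<^sup>2 * ?t z)
          + 4 * (cmod (P z))\<^sup>2 * ((cmod (P z))\<^sup>2 * ?t z))"
      proof -
        have "(4 * x + 4 * k\<^sup>2 * y + 16 * k ^ 4 * b ^ 4 + 4 * d ^ 4) * t
          = (4 * (x * t) + (4 * k\<^sup>2) * (y * t)) + (16 * k ^ 4 * b\<^sup>2 * (b\<^sup>2 * t) + 4 * d\<^sup>2 * (d\<^sup>2 * t))" for x y b d t :: real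
          by (simp add: power4_eq_xxxx power2_eq_square algebra_simps)
        then show ?thesis by blast
      qed
      \<comment> \<open>Each fourth power was split as a square times a weighted square; the growth
        bounds replace the weighted square by a constant, which also uses up the weight.\<close>
      also have "\<dots> \<le> (4 * ((cmod (deriv P z))\<^sup>2 * ?t z) + (4 * k\<^sup>2) * ((cmod (deriv (deriv w) z))\<^sup>2 * ?t z))
          + (16 * k ^ 4 * (cmod (deriv w z))\<^sup>2 * Bw + 4 * (cmod (P z))\<^sup>2 * BP)"
        by (intro add_left_mono add_mono mult_left_mono Bw BP z) auto
      finally show "(cmod (S z))\<^sup>2 * ?t z \<le> (4 * ((cmod (deriv P z))\<^sup>2 * ?t z) + (4 * k\<^sup>2) * ((cmod (deriv (deriv w) z))\<^sup>2 * ?t z))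
          + ((16 * k ^ 4 * Bw) * (cmod (deriv w z))\<^sup>2 + (4 * BP) * (cmod (P z))\<^sup>2)" by (simp only: mult_ac)
    qed
    also have "\<dots> = (moebius_integral p a (\<lambda>z. 4 * ((cmod (deriv P z))\<^sup>2 * ?t z)) + moebius_integral p a (\<lambda>z. (4 * k\<^sup>2) * ((cmod (deriv (deriv w) z))\<^sup>2 * ?t z)))
        + (moebius_integral p a (\<lambda>z. (16 * k ^ 4 * Bw) * (cmod (deriv w z))\<^sup>2) + moebius_integral p a (\<lambda>z. (4 * BP) * (cmod (P z))\<^sup>2))"
      using Bw(1) BP(1) by (subst moebius_integral_add; (intro ci | simp)?)+
    also have "\<dots> = (ennreal 4 * moebius_integral p a (\<lambda>z. (cmod (deriv P z))\<^sup>2 * ?t z) + ennreal (4 * k\<^sup>2) * moebius_integral p a (\<lambda>z. (cmod (deriv (deriv w) z))\<^sup>2 * ?t z))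
        + (ennreal (16 * k ^ 4 * Bw) * ?I (deriv w) a + ennreal (4 * BP) * ?I P a)"
      using Bw(1) BP(1) by (intro arg_cong2[of _ _ _ _ "(+)"] moebius_integral_cmult ci) auto
    also have "\<dots> \<le> (ennreal 4 * (ennreal K * ?I P a) + ennreal (4 * k\<^sup>2) * (ennreal K * ?I (deriv w) a))
        + (ennreal (16 * k ^ 4 * Bw) * ?I (deriv w) a + ennreal (4 * BP) * ?I P a)"
      unfolding K_def by (intro add_mono mult_left_mono moebius_integral_deriv assms(1) a1 hol order_refl) auto
    also have "\<dots> = ennreal (4 * K + 4 * BP) * ?I P a + ennreal (4 * k\<^sup>2 * K + 16 * k ^ 4 * Bw) * ?I (deriv w) a"
      using K BP(1) Bw(1) by (simp add: ennreal_mult ennreal_plus distrib_right mult.assoc add_ac)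
    also have "\<dots> \<le> ennreal C * ?I P a + ennreal C * ?I (deriv w) a"
    proof -
      have "4 * K + 4 * BP \<le> C" "4 * k\<^sup>2 * K + 16 * k ^ 4 * Bw \<le> C"
        using K BP(1) Bw(1) k by (simp_all add: C_def)
      from this[THEN ennreal_leI] show ?thesis by (intro add_mono mult_right_mono) auto
    qed
    finally show ?thesis by (simp only: distrib_left)
  qed
  have tS: "tends_zero_at_boundary (\<lambda>a. moebius_integral p a (\<lambda>z. (cmod (S z))\<^sup>2 * ?t z))"
    by (rule tends_zero_at_boundary_mono[OF tP tw C main])
  have "continuous_on unit_disk (\<lambda>z. (cmod (S z))\<^sup>2 * ?t z)"
    by (intro continuous_intros cont_S)
  from moebius_integral_bounded[OF assms(1) tS this]
  obtain B where B: "\<And>a. a \<in> unit_disk \<Longrightarrow> moebius_integral p a (\<lambda>z. (cmod (S z))\<^sup>2 * ?t z) \<le> ennreal B" by blast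

  let ?\<mu> = "density lborel (\<lambda>z. indicator unit_disk z * ennreal ((cmod (schwarzian h g z))\<^sup>2 * (1 - (cmod z)\<^sup>2) powr (2 + p)))"
  \<comment> \<open>Off the disk the indicator vanishes, so the explicit \<open>S\<close> may stand
    for the Schwarzian; its continuity on the disk supplies measurability.\<close>
  have \<mu>: "?\<mu> = density lborel (\<lambda>z. indicator unit_disk z * ennreal ((cmod (S z))\<^sup>2 * (1 - (cmod z)\<^sup>2) powr (2 + p)))"
    by (rule arg_cong[of _ _ "density lborel"]) (auto simp: fun_eq_iff indicator_def S)
  have int: "(\<integral>\<^sup>+ z. ennreal ((cmod (deriv (disk_auto a) z)) powr p) \<partial>?\<mu>) = moebius_integral p a (\<lambda>z. (cmod (S z))\<^sup>2 * ?t z)"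
    if "a \<in> unit_disk" for a
    unfolding \<mu> by (rule nn_integral_disk_auto_density[OF that assms(1)]) (auto intro!: continuous_intros cont_S)
  show ?thesis
    unfolding vanishing_carleson_def
  proof
    have "(SUP a\<in>unit_disk. \<integral>\<^sup>+ z. ennreal ((cmod (deriv (disk_auto a) z)) powr p) \<partial>?\<mu>) \<le> ennreal B"
      by (intro SUP_least) (simp only: int B)
    then show "(SUP a\<in>unit_disk. \<integral>\<^sup>+ z. ennreal ((cmod (deriv (disk_auto a) z)) powr p) \<partial>?\<mu>) < \<infinity>"
      by (rule order.strict_trans1) simp
    show "tends_zero_at_boundary (\<lambda>a. \<integral>\<^sup>+ z. ennreal ((cmod (deriv (disk_auto a) z)) powr p) \<partial>?\<mu>)"
      \<comment> \<open>The formula \<open>int\<close> holds for centres in the disk only, so the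
        limit is obtained by domination and not by rewriting the function of
        \<open>a\<close>.\<close>
      by (rule tends_zero_at_boundary_mono[OF tP tw C]) (simp only: int main)
  qed
qed

end
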